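(* Let $\mathfrak{L}$ be a finite-dimensional semi-simple left Leibniz algebra over a field of characteristic zero. If $M$ is a finite-dimensional $\mathfrak{L}$-bimodule such that $M^{\mathfrak{L}}=0$, then $\mathrm{HL}^n(\mathfrak{L},M)=0$ for every non-negative integer $n$.
   Context: A left Leibniz algebra over $\mathbb{F}$ is a vector space $\mathfrak{L}$ with bilinear product satisfying $x(yz)=(xy)z+y(xz)$. $\mathrm{Leib}(\mathfrak{L})=\langle x^2\mid x\in\mathfrak{L}\rangle_{\mathbb{F}}$ and $\mathfrak{L}_{\mathrm{Lie}}=\mathfrak{L}/\mathrm{Leib}(\mathfrak{L})$. $\mathfrak{L}$ is semi-simple if $\mathrm{Leib}(\mathfrak{L})$ contains every solvable ideal of $\mathfrak{L}$ (equivalently $\mathfrak{L}_{\mathrm{Lie}}$ is semi-simple). An $\mathfrak{L}$-bimodule is a vector space $M$ with bilinear actions $x\cdot m$, $m\cdot x$ satisfying $(xy)\cdot m=x\cdot(y\cdot m)-y\cdot(x\cdot m)$, $(x\cdot m)\cdot y=x\cdot(m\cdot y)-m\cdot(xy)$, $(m\cdot x)\cdot y=m\cdot(xy)-x\cdot(m\cdot y)$. $M^{\mathfrak{L}}:=\{m\in M\mid m\cdot x=0\ \forall x\in\mathfrak{L}\}$ (right invariants). Leibniz cohomology $\mathrm{HL}^n(\mathfrak{L},M)$ is the cohomology of $\mathrm{CL}^n(\mathfrak{L},M)=\mathrm{Hom}_{\mathbb{F}}(\mathfrak{L}^{\otimes n},M)$ with coboundary $(\mathrm{d}^nf)(x_1,\dots,x_{n+1})=\sum_{i=1}^n(-1)^{i+1}x_i\cdot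 f(\dots,\hat{x}_i,\dots)+(-1)^{n+1}f(x_1,\dots,x_n)\cdot x_{n+1}+\sum_{i<j}(-1)^if(x_1,\dots,\hat{x}_i,\dots,x_ix_j,\dots,x_{n+1})$, with $x_ix_j$ in the $j$-th position. *)

theory Defs
  imports Complex_Main
begin

definition bilinear_map ::
  "('f::field \<Rightarrow> 'a::ab_group_add \<Rightarrow> 'a) \<Rightarrow> ('f \<Rightarrow> 'b::ab_group_add \<Rightarrow> 'b) \<Rightarrow>
   ('f \<Rightarrow> 'c::ab_group_add \<Rightarrow> 'c) \<Rightarrow> ('a \<Rightarrow> 'b \<Rightarrow> 'c) \<Rightarrow> bool" where
  "bilinear_map sA sB sC g \<longleftrightarrow>
     (\<forall>a. Vector_Spaces.linear sB sC (g a)) \<and> (\<forall>b. Vector_Spaces.linear sA sC (\<lambda>a. g a b))"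

definition leibniz_algebra ::
  "('f::field \<Rightarrow> 'l::ab_group_add \<Rightarrow> 'l) \<Rightarrow> ('l \<Rightarrow> 'l \<Rightarrow> 'l) \<Rightarrow> bool" where
  "leibniz_algebra sL mult \<longleftrightarrow>
     vector_space sL \<and> bilinear_map sL sL sL mult \<and>
     (\<forall>x y z. mult x (mult y z) = mult (mult x y) z + mult y (mult x z))"

definition fin_dim :: "('f::field \<Rightarrow> 'v::ab_group_add \<Rightarrow> 'v) \<Rightarrow> bool" where
  "fin_dim s \<longleftrightarrow> (\<exists>B. finite_dimensional_vector_space s B)"

definition Leib :: "('f::field \<Rightarrow> 'l::ab_group_add \<Rightarrow> 'l) \<Rightarrow> ('l \<Rightarrow> 'l \<Rightarrow> 'l) \<Rightarrow> 'l set" where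
  "Leib sL mult = module.span sL (range (\<lambda>x. mult x x))"

definition leib_ideal :: "('f::field \<Rightarrow> 'l::ab_group_add \<Rightarrow> 'l) \<Rightarrow> ('l \<Rightarrow> 'l \<Rightarrow> 'l) \<Rightarrow> 'l set \<Rightarrow> bool" where
  "leib_ideal sL mult I \<longleftrightarrow> module.subspace sL I \<and>
     (\<forall>x y. y \<in> I \<longrightarrow> mult x y \<in> I \<and> mult y x \<in> I)"

fun derived :: "('f::field \<Rightarrow> 'l::ab_group_add \<Rightarrow> 'l) \<Rightarrow> ('l \<Rightarrow> 'l \<Rightarrow> 'l) \<Rightarrow> nat \<Rightarrow> 'l set \<Rightarrow> 'l set" where
  "derived sL mult 0 I = I"
| "derived sL mult (Suc k) I =
     module.span sL {mult a b | a b. a \<in> derived sL mult k I \<and> b \<in> derived sL mult k I}"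

definition solvable_ideal :: "('f::field \<Rightarrow> 'l::ab_group_add \<Rightarrow> 'l) \<Rightarrow> ('l \<Rightarrow> 'l \<Rightarrow> 'l) \<Rightarrow> 'l set \<Rightarrow> bool" where
  "solvable_ideal sL mult I \<longleftrightarrow> leib_ideal sL mult I \<and> (\<exists>k. derived sL mult k I = {0})"

definition semisimple :: "('f::field \<Rightarrow> 'l::ab_group_add \<Rightarrow> 'l) \<Rightarrow> ('l \<Rightarrow> 'l \<Rightarrow> 'l) \<Rightarrow> bool" where
  "semisimple sL mult \<longleftrightarrow> (\<forall>I. solvable_ideal sL mult I \<longrightarrow> I \<subseteq> Leib sL mult)"

definition leib_bimodule ::
  "('f::field \<Rightarrow> 'l::ab_group_add \<Rightarrow> 'l) \<Rightarrow> ('l \<Rightarrow> 'l \<Rightarrow> 'l) \<Rightarrow>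
   ('f \<Rightarrow> 'm::ab_group_add \<Rightarrow> 'm) \<Rightarrow> ('l \<Rightarrow> 'm \<Rightarrow> 'm) \<Rightarrow> ('m \<Rightarrow> 'l \<Rightarrow> 'm) \<Rightarrow> bool" where
  "leib_bimodule sL mult sM lact ract \<longleftrightarrow>
     vector_space sM \<and> bilinear_map sL sM sM lact \<and> bilinear_map sM sL sM ract \<and>
     (\<forall>x y m. lact (mult x y) m = lact x (lact y m) - lact y (lact x m)) \<and>
     (\<forall>x y m. ract (lact x m) y = lact x (ract m y) - ract m (mult x y)) \<and>
     (\<forall>x y m. ract (ract m x) y = ract m (mult x y) - lact x (ract m y))"

definition right_inv :: "('m::ab_group_add \<Rightarrow> 'l \<Rightarrow> 'm) \<Rightarrow> 'm set" where
  "right_inv ract = {m. \<forall>x. ract m x = 0}"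

text \<open>n-cochains: maps on lists of length n (= L^{\<otimes> n}) linear in each slot.
  Values on lists of other lengths are irrelevant.\<close>
definition cochain ::
  "('f::field \<Rightarrow> 'l::ab_group_add \<Rightarrow> 'l) \<Rightarrow> ('f \<Rightarrow> 'm::ab_group_add \<Rightarrow> 'm) \<Rightarrow> nat \<Rightarrow> ('l list \<Rightarrow> 'm) \<Rightarrow> bool" where
  "cochain sL sM n f \<longleftrightarrow>
     (\<forall>xs i. length xs = n \<and> i < n \<longrightarrow> Vector_Spaces.linear sL sM (\<lambda>y. f (xs[i := y])))"

definition sgnp :: "nat \<Rightarrow> 'm::ab_group_add \<Rightarrow> 'm" where
  "sgnp k v = (if even k then v else - v)"

definition del :: "nat \<Rightarrow> 'a list \<Rightarrow> 'a list" where
  "del i xs = take i xs @ drop (Suc i) xs"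

text \<open>Coboundary d^n, 0-indexed: on a list xs of length n+1,
  sum_{i<n} (-1)^i xs!i . f(del i xs) + (-1)^(n+1) f(take n xs) . xs!n
  + sum_{i<j<=n} (-1)^(i+1) f(del i (xs[j := xs!i xs!j])).
  (This is the paper's formula with 1-based indices shifted.)\<close>
definition cobound ::
  "('l::ab_group_add \<Rightarrow> 'l \<Rightarrow> 'l) \<Rightarrow> ('l \<Rightarrow> 'm::ab_group_add \<Rightarrow> 'm) \<Rightarrow> ('m \<Rightarrow> 'l \<Rightarrow> 'm) \<Rightarrow>
   nat \<Rightarrow> ('l list \<Rightarrow> 'm) \<Rightarrow> 'l list \<Rightarrow> 'm" where
  "cobound mult lact ract n f xs =
     (\<Sum>i<n. sgnp i (lact (xs ! i) (f (del i xs))))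
     + sgnp (Suc n) (ract (f (take n xs)) (xs ! n))
     + (\<Sum>j\<in>{..n}. \<Sum>i<j. sgnp (Suc i) (f (del i (xs[j := mult (xs ! i) (xs ! j)]))))"

definition HL_vanishes ::
  "('f::field \<Rightarrow> 'l::ab_group_add \<Rightarrow> 'l) \<Rightarrow> ('l \<Rightarrow> 'l \<Rightarrow> 'l) \<Rightarrow>
   ('f \<Rightarrow> 'm::ab_group_add \<Rightarrow> 'm) \<Rightarrow> ('l \<Rightarrow> 'm \<Rightarrow> 'm) \<Rightarrow> ('m \<Rightarrow> 'l \<Rightarrow> 'm) \<Rightarrow> nat \<Rightarrow> bool" where
  "HL_vanishes sL mult sM lact ract n \<longleftrightarrow>
     (\<forall>f. cochain sL sM n f \<and>
          (\<forall>xs. length xs = Suc n \<longrightarrow> cobound mult lact ract n f xs = 0) \<longrightarrow>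
        (case n of
           0 \<Rightarrow> f [] = 0
         | Suc k \<Rightarrow> (\<exists>g. cochain sL sM k g \<and>
                      (\<forall>xs. length xs = n \<longrightarrow> f xs = cobound mult lact ract k g xs))))"

end

(*
The identity (x.m + m.x).y = 0 holds in every bimodule, so M^L = 0 forces m.x = -x.m, and M is a left
module without nonzero invariants. Let i_x insert x as first argument and let theta_x be the natural action of
L on cochains; Cartan's formula theta_x = d i_x + i_x d shows that L acts trivially on cohomology.
By complete reducibility in the form of Whitehead's first lemma (if L v lies in a finite-dimensional submodule W,
then v - w is invariant for some w in W) a cocycle f may be taken invariant. Then each i_x f is a cocycle,
by induction i_x f = d g_x with g_x linear in x, and Whitehead's lemma again makes g equivariant.
Reading g as a cochain of one degree more, Cartan's formula yields i_x d g = -d g_x = -i_x f, that is, f = -d g.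

Whitehead's lemma is reduced to a trivial W by a Casimir operator, whose trace on W is the dimension of
an ideal modulo Leib, hence nonzero in characteristic 0. The required nondegeneracy of the trace form is
Cartan's criterion, proved by Jordan decomposition over the algebraic closure and Engel's theorem.
*)
theory Submission
  imports Defs "HOL-Library.Function_Algebras" "HOL-Algebra.Algebraic_Closure_Type"
    "Jordan_Normal_Form.Jordan_Normal_Form_Existence"
begin

section \<open>Triangular and Jordan form over an algebraically closed field\<close>

text \<open>The quotient by \<open>Leib\<close> is never formed. Lie theory is redone modulo
  \<open>Leib\<close>: ideals are shown to lie in \<open>Leib\<close> rather than to vanish, and
  wherever antisymmetry of the bracket would be used, only the fact that xy + yx acts as zero is
  available. Cochains of all degrees share one infinite-dimensional type, so modules sit inside an
  ambient space of any dimension, and matrices occur only for a finite-dimensional submodule. In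
  Cartan's criterion the Jordan form lives over the algebraic closure while the algebra stays over
  the ground field; the two are linked only by traces against a test matrix. The classical
  polynomial that expresses ad of the test matrix through ad Z is replaced by the independence of
  recurrent sequences with distinct characteristic roots. Whitehead's lemma with trivial action on
  \<open>W\<close> rests on L being spanned by products and \<open>Leib\<close>, which holds because
  the radical of the Killing form is exactly \<open>Leib\<close>.\<close>

lemma invertible_first_column:
  fixes v :: "'a::field vec"
  assumes v: "v \<in> carrier_vec n" and v0: "v \<noteq> 0\<^sub>v n"
  shows "\<exists>W W'. W \<in> carrier_mat n n \<and> W' \<in> carrier_mat n n \<and> W * W' = 1\<^sub>m n \<and> W' * W = 1\<^sub>m n \<and> col W 0 = v"
proof -
  from v v0 obtain k where k: "k < n" "v $ k \<noteq> 0" by (metis carrier_vecD eq_vecI index_zero_vec)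
  \<comment> \<open>For \<open>j > 0\<close> column \<open>j\<close> of \<open>W\<close> is a unit
    vector; \<open>idx\<close> enumerates all positions except \<open>k\<close>, where
    \<open>v\<close> is nonzero. Row \<open>k\<close> therefore sees only the first column.\<close>
  define idx where "idx = (\<lambda>j. if j \<le> k then j - 1 else j)"
  define W where "W = mat n n (\<lambda>(i,j). if j = 0 then v $ i else if i = idx j then 1 else 0)"
  have W: "W \<in> carrier_mat n n" by (simp add: W_def)
  have "det W \<noteq> 0"
  proof
    assume "det W = 0"
    then obtain w where w: "w \<in> carrier_vec n" "w \<noteq> 0\<^sub>v n" and Ww: "W *\<^sub>v w = 0\<^sub>v n"
      using det_0_iff_vec_prod_zero[OF W] by blast
    have row: "(\<Sum>j\<in>{0..<n}. (if j = 0 then v $ i else if i = idx j then 1 else 0) * w $ j) = 0" if "i < n" for i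
      using arg_cong[OF Ww, of "\<lambda>u. vec_index u i"] that w by (simp add: W_def scalar_prod_def)
    have n: "n > 0" using k by simp
    have expand: "v $ i * w $ 0 + (\<Sum>j\<in>{0<..<n}. (if i = idx j then 1 else 0) * w $ j) = 0" if "i < n" for i
    proof -
      have "{0..<n} = insert 0 {0<..<n}" using n by auto
      thus ?thesis using row[OF that] by simp
    qed
    have "(\<Sum>j\<in>{0<..<n}. (if k = idx j then 1 else 0) * w $ j) = 0"
      by (rule sum.neutral) (auto simp: idx_def)
    hence w0: "w $ 0 = 0" using expand[OF k(1)] k(2) by simp
    have "w $ j = 0" if j: "j < n" for j
    proof (cases "j = 0")
      case False
      have inj: "idx j = idx j' \<longleftrightarrow> j' = j" if "j' > 0" for j' using False that by (auto simp: idx_def)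
      have "(\<Sum>j'\<in>{0<..<n}. (if idx j = idx j' then 1 else 0) * w $ j') = (\<Sum>j'\<in>{0<..<n}. if j' = j then w $ j' else 0)"
        by (rule sum.cong) (auto simp: inj)
      moreover have "idx j < n" using j by (auto simp: idx_def)
      ultimately show ?thesis using expand[of "idx j"] w0 j False by simp
    qed (simp add: w0)
    hence "w = 0\<^sub>v n" using w(1) by auto
    with w(2) show False by simp
  qed
  from det_non_zero_imp_unit[OF W this, of "()"] obtain W' where
    "W' \<in> carrier_mat n n" "W * W' = 1\<^sub>m n" "W' * W = 1\<^sub>m n"
    unfolding Units_def ring_mat_def by auto
  moreover have "col W 0 = v" using k v by (intro eq_vecI) (auto simp: W_def)
  ultimately show ?thesis using W by blast
qed

text \<open>Deflation: an eigenvector as first column of the base change leaves zeros below the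
  corner, and the lower right block is treated by induction.\<close>

lemma alg_closed_similar_upper_triangular:
  fixes A :: "'a::alg_closed_field mat"
  assumes "A \<in> carrier_mat n n"
  shows "\<exists>B\<in>carrier_mat n n. upper_triangular B \<and> similar_mat A B"
  using assms
proof (induction n arbitrary: A)
  case 0
  then show ?case by (intro bexI[of _ A]) (auto intro: similar_mat_refl simp: upper_triangular_def)
next
  case (Suc n)
  have deg: "degree (char_poly A) > 0" using degree_monic_char_poly[OF Suc.prems] by simp
  then obtain e where "poly (char_poly A) e = 0" using alg_closed_imp_poly_has_root by blast
  hence "eigenvalue A e" using eigenvalue_root_char_poly[OF Suc.prems] by simp
  then obtain v where v: "v \<in> carrier_vec (Suc n)" "v \<noteq> 0\<^sub>v (Suc n)" "A *\<^sub>v v = e \<cdot>\<^sub>v v"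
    using Suc.prems unfolding eigenvalue_def eigenvector_def by auto
  from invertible_first_column[OF v(1,2)] obtain W W' where
    W: "W \<in> carrier_mat (Suc n) (Suc n)" and W': "W' \<in> carrier_mat (Suc n) (Suc n)"
    and inv: "W * W' = 1\<^sub>m (Suc n)" "W' * W = 1\<^sub>m (Suc n)" and c0: "col W 0 = v" by blast
  define A' where "A' = W' * A * W"
  have A': "A' \<in> carrier_mat (Suc n) (Suc n)" using W W' Suc.prems by (simp add: A'_def)
  have sim: "similar_mat A A'"
  proof (rule similar_matI[of _ _ W W' "Suc n"])
    have "W * A' * W' = (W * W') * A * (W * W')" unfolding A'_def
      using W W' Suc.prems by (simp add: assoc_mult_mat[of _ "Suc n" "Suc n" _ "Suc n" _ "Suc n"])
    thus "A = W * A' * W'" using inv Suc.prems by simp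
  qed (use W W' A' inv Suc.prems in auto)
  have "col A' 0 = W' *\<^sub>v (A *\<^sub>v col W 0)"
    unfolding A'_def using W W' Suc.prems
    using v(1) by (subst col_mult2[of _ "Suc n" "Suc n" _ "Suc n"]) (auto simp: c0 assoc_mult_mat_vec[of _ "Suc n" "Suc n" _ "Suc n"])
  also have "\<dots> = e \<cdot>\<^sub>v (W' *\<^sub>v col W 0)" using v W' c0 by (simp add: mult_mat_vec)
  also have "W' *\<^sub>v col W 0 = col (W' * W) 0" using W W' by (subst col_mult2[of _ "Suc n" "Suc n" _ "Suc n"]) auto
  finally have colA': "col A' 0 = e \<cdot>\<^sub>v unit_vec (Suc n) 0" using inv by simp
  obtain A1 A2 A0 A3 where split: "split_block A' 1 1 = (A1,A2,A0,A3)" by (cases "split_block A' 1 1") auto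
  have d: "dim_row A' = 1 + n" "dim_col A' = 1 + n" using A' by auto
  note sb = split_block[OF split d]
  have A0: "A0 = 0\<^sub>m n 1"
  proof (rule eq_matI)
    fix i j assume "i < dim_row (0\<^sub>m n 1)" "j < dim_col (0\<^sub>m n 1)"
    then show "A0 $$ (i,j) = 0\<^sub>m n 1 $$ (i,j)"
      using arg_cong[OF colA', of "\<lambda>u. vec_index u (Suc i)"] split d by (auto simp: split_block_def Let_def)
  qed (use sb in auto)
  from Suc.IH[OF sb(4)] obtain B where B: "B \<in> carrier_mat n n" "upper_triangular B" "similar_mat A3 B" by blast
  from similar_mat_four_block_0_ex[OF similar_mat_refl[OF sb(1)] B(3) sb(2) sb(1) sb(4)]
  obtain B0 where B0: "B0 \<in> carrier_mat 1 n"
    and simB: "similar_mat (four_block_mat A1 A2 (0\<^sub>m n 1) A3) (four_block_mat A1 B0 (0\<^sub>m n 1) B)" by blast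
  let ?B = "four_block_mat A1 B0 (0\<^sub>m n 1) B"
  have "upper_triangular A1" using sb(1) by (auto simp: upper_triangular_def)
  hence "upper_triangular ?B" by (rule upper_triangular_four_block[OF sb(1) B(1) _ B(2)])
  moreover have "similar_mat A ?B" using similar_mat_trans[OF sim] simB sb(5) A0 by simp
  moreover have "?B \<in> carrier_mat (Suc n) (Suc n)" using four_block_carrier_mat[OF sb(1) B(1)] by simp
  ultimately show ?case by blast
qed

text \<open>An off-diagonal entry lies inside one Jordan block, where the diagonal is constant. This
  is the commutation of the diagonal part with the nilpotent part, in entrywise form.\<close>

lemma jordan_matrix_offdiag:
  assumes "i < sum_list (map fst n_as)" "j < sum_list (map fst n_as)" "i \<noteq> j" "jordan_matrix n_as $$ (i,j) \<noteq> 0"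
  shows "i < j \<and> jordan_matrix n_as $$ (i,i) = jordan_matrix n_as $$ (j,j)"
  using assms
proof (induction n_as arbitrary: i j)
  case (Cons na n_as)
  obtain n a where [simp]: "na = (n, a)" by (cases na)
  let ?m = "sum_list (map fst n_as)"
  show ?case
  proof (cases "i < n \<and> j < n \<or> i \<ge> n \<and> j \<ge> n")
    case True
    then show ?thesis
    proof
      assume "i < n \<and> j < n"
      thus ?thesis using Cons.prems by (auto simp: jordan_matrix_Cons split: if_splits)
    next
      assume "i \<ge> n \<and> j \<ge> n"
      thus ?thesis using Cons.prems Cons.IH[of "i - n" "j - n"]
        by (auto simp: jordan_matrix_Cons less_diff_conv2)
    qed
  next
    case False
    thus ?thesis using Cons.prems by (auto simp: jordan_matrix_Cons split: if_splits)
  qed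
qed simp

section \<open>Trace forms and nilpotency\<close>

definition mtrace :: "'a::comm_ring_1 mat \<Rightarrow> 'a" where
  "mtrace A = (\<Sum>i<dim_row A. A $$ (i,i))"

lemma mtrace_comm:
  assumes "A \<in> carrier_mat n m" "B \<in> carrier_mat m n"
  shows "mtrace (A * B) = mtrace (B * A)"
proof -
  have "mtrace (A * B) = (\<Sum>i<n. \<Sum>j<m. A $$ (i,j) * B $$ (j,i))"
    using assms by (auto simp: mtrace_def scalar_prod_def lessThan_atLeast0 intro!: sum.cong)
  also have "\<dots> = (\<Sum>j<m. \<Sum>i<n. A $$ (i,j) * B $$ (j,i))" by (rule sum.swap)
  also have "\<dots> = mtrace (B * A)"
    using assms by (auto simp: mtrace_def scalar_prod_def lessThan_atLeast0 mult.commute intro!: sum.cong)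
  finally show ?thesis .
qed

lemma mtrace_add: "A \<in> carrier_mat n n \<Longrightarrow> B \<in> carrier_mat n n \<Longrightarrow> mtrace (A + B) = mtrace A + mtrace B"
  by (simp add: mtrace_def sum.distrib)

lemma mtrace_minus: "A \<in> carrier_mat n n \<Longrightarrow> B \<in> carrier_mat n n \<Longrightarrow> mtrace (A - B) = mtrace A - mtrace B"
  by (simp add: mtrace_def sum_subtractf)

lemma mtrace_smult: "A \<in> carrier_mat n n \<Longrightarrow> mtrace (c \<cdot>\<^sub>m A) = c * mtrace A"
  by (simp add: mtrace_def sum_distrib_left)

lemma mtrace_zero: "mtrace (0\<^sub>m n n) = 0"
  by (simp add: mtrace_def)

text \<open>Cyclicity of the trace. It gives the invariance of trace forms and moves a commutator
  onto the test matrix in Cartan's criterion.\<close>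

lemma mtrace_commutator_mult:
  fixes A B Y :: "'a::comm_ring_1 mat"
  assumes "A \<in> carrier_mat n n" "B \<in> carrier_mat n n" "Y \<in> carrier_mat n n"
  shows "mtrace ((A * B - B * A) * Y) = mtrace (A * (B * Y - Y * B))"
proof -
  note [simp] = assms
  have "(A * B - B * A) * Y = A * (B * Y) - B * (A * Y)"
    using minus_mult_distrib_mat[of "A * B" n n "B * A" Y n] mult_carrier_mat[of A n n B n] mult_carrier_mat[of B n n A n]
    by (simp add: assoc_mult_mat[of _ n n _ n _ n])
  hence "mtrace ((A * B - B * A) * Y) = mtrace (A * (B * Y)) - mtrace (B * (A * Y))"
    by (simp add: mtrace_minus[of _ n] mult_carrier_mat[of _ n n _ n])
  also have "mtrace (B * (A * Y)) = mtrace (A * (Y * B))"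
    by (subst mtrace_comm[of _ n n]) (simp_all add: assoc_mult_mat[of _ n n _ n _ n] mult_carrier_mat[of _ n n _ n])
  finally show ?thesis
    by (simp add: mult_minus_distrib_mat[of _ n n _ n] mtrace_minus[of _ n] mult_carrier_mat[of _ n n _ n])
qed

lemma mtrace_similar:
  fixes A B :: "'a::comm_ring_1 mat"
  assumes "similar_mat A B"
  shows "mtrace A = mtrace B"
proof -
  from similar_matD[OF assms] obtain n P Q where *: "{A,B,P,Q} \<subseteq> carrier_mat n n" "Q * P = 1\<^sub>m n" "A = P * B * Q"
    by blast
  have "mtrace A = mtrace (P * (B * Q))" using * by (simp add: assoc_mult_mat[of _ n n _ n _ n])
  also have "\<dots> = mtrace (B * (Q * P))" using *
    by (subst mtrace_comm[of _ n n]) (auto simp: assoc_mult_mat[of _ n n _ n _ n])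
  finally show ?thesis using * right_mult_one_mat[of B n n] by auto
qed

section \<open>Linear recurrences: powers of the shift operator minus a scalar\<close>

definition seq_shift :: "'a::comm_ring_1 \<Rightarrow> (nat \<Rightarrow> 'a) \<Rightarrow> nat \<Rightarrow> 'a" where
  "seq_shift \<mu> s = (\<lambda>k. s (Suc k) - \<mu> * s k)"

lemma seq_shift_commute: "seq_shift \<mu> (seq_shift \<nu> s) = seq_shift \<nu> (seq_shift \<mu> s)"
  by (auto simp: seq_shift_def algebra_simps)

lemma seq_shift_pow_commute: "(seq_shift \<mu> ^^ m) ((seq_shift \<nu> ^^ l) s) = (seq_shift \<nu> ^^ l) ((seq_shift \<mu> ^^ m) s)"
proof -
  have 1: "seq_shift \<mu> ((seq_shift \<nu> ^^ l) s) = (seq_shift \<nu> ^^ l) (seq_shift \<mu> s)" for s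
    by (induction l) (simp_all add: seq_shift_commute[of \<mu> \<nu>])
  show ?thesis by (induction m) (simp_all add: 1)
qed

lemma seq_shift_pow_sum: "(seq_shift \<mu> ^^ m) (\<lambda>k. \<Sum>i\<in>I. s i k) = (\<lambda>k. \<Sum>i\<in>I. (seq_shift \<mu> ^^ m) (s i) k)"
  by (induction m) (simp_all add: seq_shift_def sum_subtractf sum_distrib_left)

lemma seq_shift_pow_zero: "(seq_shift \<mu> ^^ m) (\<lambda>k. 0) = (\<lambda>k. 0)"
  by (induction m) (simp_all add: seq_shift_def)

text \<open>The kernel of \<open>seq_shift \<mu>\<close> consists of the geometric sequences with
  ratio \<mu>, on which \<open>seq_shift \<nu>\<close> is multiplication by \<mu> - \<nu>. Induction
  on \<open>m\<close> reduces to this case.\<close>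

lemma seq_shift_kernels_disjoint:
  fixes \<mu> \<nu> :: "'a::idom"
  assumes "(seq_shift \<mu> ^^ m) s = (\<lambda>k. 0)" "(seq_shift \<nu> ^^ l) s = (\<lambda>k. 0)" "\<mu> \<noteq> \<nu>"
  shows "s = (\<lambda>k. 0)"
  using assms
proof (induction m arbitrary: s)
  case (Suc m)
  have "seq_shift \<mu> s = (\<lambda>k. 0)"
  proof (rule Suc.IH)
    show "(seq_shift \<mu> ^^ m) (seq_shift \<mu> s) = (\<lambda>k. 0)" using Suc.prems(1) by (simp add: funpow_swap1)
    show "(seq_shift \<nu> ^^ l) (seq_shift \<mu> s) = (\<lambda>k. 0)"
      using seq_shift_pow_commute[of l \<nu> 1 \<mu> s] Suc.prems(2) by (simp add: seq_shift_def)
  qed fact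
  hence *: "s (Suc k) = \<mu> * s k" for k by (metis (no_types) eq_iff_diff_eq_0 seq_shift_def)
  have "(seq_shift \<nu> ^^ l) s = (\<lambda>k. (\<mu> - \<nu>) ^ l * s k)"
    by (induction l) (simp_all add: seq_shift_def * algebra_simps)
  with Suc.prems show ?case by (auto simp: fun_eq_iff)
qed simp

text \<open>Applying \<open>seq_shift \<nu> ^^ m\<close> removes one summand and keeps the others
  annihilated by their own operators. By induction the images vanish, and disjointness of the
  kernels carries this back to the sequences.\<close>

lemma seq_shift_independent:
  fixes s :: "'a::idom \<Rightarrow> nat \<Rightarrow> 'a"
  assumes "finite \<Omega>" "\<And>k. (\<Sum>\<mu>\<in>\<Omega>. s \<mu> k) = 0" "\<And>\<mu>. \<mu> \<in> \<Omega> \<Longrightarrow> (seq_shift \<mu> ^^ m) (s \<mu>) = (\<lambda>k. 0)" "\<mu> \<in> \<Omega>"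
  shows "s \<mu> k = 0"
proof -
  have "\<forall>\<mu>\<in>\<Omega>. s \<mu> = (\<lambda>k. 0)" using assms(1-3)
  proof (induction \<Omega> arbitrary: s rule: finite_induct)
    case (insert \<nu> \<Omega>)
    let ?t = "\<lambda>\<mu>. (seq_shift \<nu> ^^ m) (s \<mu>)"
    have "\<forall>\<mu>\<in>\<Omega>. ?t \<mu> = (\<lambda>k. 0)"
    proof (rule insert.IH)
      fix k
      have "(\<lambda>k. \<Sum>\<mu>\<in>insert \<nu> \<Omega>. ?t \<mu> k) = (\<lambda>k. 0)"
        using seq_shift_pow_sum[of m \<nu> s "insert \<nu> \<Omega>"] insert.prems(1) by (simp add: seq_shift_pow_zero)
      with insert.prems(2)[of \<nu>] insert.hyps show "(\<Sum>\<mu>\<in>\<Omega>. ?t \<mu> k) = 0"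
        by (auto simp: fun_eq_iff)
    next
      fix \<mu> assume "\<mu> \<in> \<Omega>"
      thus "(seq_shift \<mu> ^^ m) (?t \<mu>) = (\<lambda>k. 0)"
        using insert.prems(2)[of \<mu>] by (simp add: seq_shift_pow_commute[of _ \<mu>] seq_shift_pow_zero)
    qed
    hence *: "s \<mu> = (\<lambda>k. 0)" if "\<mu> \<in> \<Omega>" for \<mu>
      using that insert.prems(2)[of \<mu>] insert.hyps by (intro seq_shift_kernels_disjoint[of m \<mu> "s \<mu>" m \<nu>]) auto
    moreover have "s \<nu> k = 0" for k using insert.prems(1)[of k] insert.hyps * by simp
    ultimately show ?case by auto
  qed simp
  with assms(4) show ?thesis by simp
qed

text \<open>In characteristic zero the field is a rational vector space, and a nonzero element
  extends to a basis. Rational values are wanted because their squares sum to zero only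
  termwise.\<close>

lemma rat_functional_nonzero:
  fixes a :: "'a::field_char_0"
  assumes "a \<noteq> 0"
  shows "\<exists>f :: 'a \<Rightarrow> rat. (\<forall>x y. f (x + y) = f x + f y) \<and> (\<forall>q x. f (of_rat q * x) = q * f x) \<and> f a \<noteq> 0"
proof -
  let ?sc = "\<lambda>(q::rat) (x::'a). of_rat q * x"
  let ?sq = "\<lambda>(q::rat) (x::rat). q * x"
  interpret vector_space_pair ?sc ?sq
    by unfold_locales (auto simp: algebra_simps of_rat_add of_rat_mult)
  have "vs1.independent {a}" using assms by simp
  from linear_independent_extend[OF this, of "\<lambda>_. 1"] obtain g where
    g: "Vector_Spaces.linear ?sc ?sq g" "g a = 1" by auto
  then interpret g: Vector_Spaces.linear ?sc ?sq g by simp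
  show ?thesis using g by (intro exI[of _ g]) (auto simp: g.add g.scale)
qed

text \<open>Subtracting the diagonal of a Jordan matrix leaves a nilpotent part commuting with it, so on each
  eigenspace of the commutator with the diagonal, the commutator with the Jordan matrix is nilpotent
  up to the eigenvalue.\<close>

definition graded_band :: "nat \<Rightarrow> (nat \<Rightarrow> 'a::comm_ring_1) \<Rightarrow> 'a \<Rightarrow> int \<Rightarrow> 'a mat \<Rightarrow> bool" where
  "graded_band n l \<mu> h V \<longleftrightarrow> V \<in> carrier_mat n n \<and>
     (\<forall>i<n. \<forall>j<n. V $$ (i,j) \<noteq> 0 \<longrightarrow> l i - l j = \<mu> \<and> int j - int i \<ge> h)"

text \<open>On such a \<open>V\<close> the diagonal of \<open>J\<close> contributes exactly the
  factor \<mu>, which cancels. The other entries of \<open>J\<close> preserve eigenvalue differences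
  and are strictly upper, so each surviving term lies at least one band further up.\<close>

lemma graded_band_step:
  fixes J :: "'a::idom mat"
  assumes J: "J \<in> carrier_mat n n"
    and off: "\<And>i j. i < n \<Longrightarrow> j < n \<Longrightarrow> i \<noteq> j \<Longrightarrow> J $$ (i,j) \<noteq> 0 \<Longrightarrow> i < j \<and> J $$ (i,i) = J $$ (j,j)"
    and V: "graded_band n (\<lambda>i. J $$ (i,i)) \<mu> h V"
  shows "graded_band n (\<lambda>i. J $$ (i,i)) \<mu> (h + 1) (J * V - V * J - \<mu> \<cdot>\<^sub>m V)"
  unfolding graded_band_def
proof (intro conjI allI impI)
  have Vc: "V \<in> carrier_mat n n"
    and Vz: "\<And>i j. i < n \<Longrightarrow> j < n \<Longrightarrow> V $$ (i,j) \<noteq> 0 \<Longrightarrow> J $$ (i,i) - J $$ (j,j) = \<mu> \<and> int j - int i \<ge> h"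
    using V by (auto simp: graded_band_def)
  show "J * V - V * J - \<mu> \<cdot>\<^sub>m V \<in> carrier_mat n n" using J Vc by auto
  fix i j assume i: "i < n" and j: "j < n" and nz: "(J * V - V * J - \<mu> \<cdot>\<^sub>m V) $$ (i,j) \<noteq> 0"
  have "(J * V - V * J - \<mu> \<cdot>\<^sub>m V) $$ (i,j) =
      (\<Sum>k<n. J $$ (i,k) * V $$ (k,j)) - (\<Sum>k<n. V $$ (i,k) * J $$ (k,j)) - \<mu> * V $$ (i,j)"
    using i j J Vc by (simp add: scalar_prod_def lessThan_atLeast0)
  also have "(\<Sum>k<n. J $$ (i,k) * V $$ (k,j)) = J $$ (i,i) * V $$ (i,j) + (\<Sum>k\<in>{..<n}-{i}. J $$ (i,k) * V $$ (k,j))"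
    using i by (simp add: sum.remove)
  also have "(\<Sum>k<n. V $$ (i,k) * J $$ (k,j)) = V $$ (i,j) * J $$ (j,j) + (\<Sum>k\<in>{..<n}-{j}. V $$ (i,k) * J $$ (k,j))"
    using j by (simp add: sum.remove)
  finally have eq: "(J * V - V * J - \<mu> \<cdot>\<^sub>m V) $$ (i,j) =
      (J $$ (i,i) - J $$ (j,j) - \<mu>) * V $$ (i,j) + (\<Sum>k\<in>{..<n}-{i}. J $$ (i,k) * V $$ (k,j))
      - (\<Sum>k\<in>{..<n}-{j}. V $$ (i,k) * J $$ (k,j))"
    by (simp add: algebra_simps)
  have "(J $$ (i,i) - J $$ (j,j) - \<mu>) * V $$ (i,j) = 0" using Vz[OF i j] by auto
  with eq nz have "(\<Sum>k\<in>{..<n}-{i}. J $$ (i,k) * V $$ (k,j)) \<noteq> 0 \<or> (\<Sum>k\<in>{..<n}-{j}. V $$ (i,k) * J $$ (k,j)) \<noteq> 0"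
    by auto
  then obtain k where "k < n" "k \<noteq> i \<and> J $$ (i,k) * V $$ (k,j) \<noteq> 0 \<or> k \<noteq> j \<and> V $$ (i,k) * J $$ (k,j) \<noteq> 0"
    by (metis (no_types, lifting) DiffE insertI1 lessThan_iff sum.neutral)
  thus "J $$ (i,i) - J $$ (j,j) = \<mu>" "int j - int i \<ge> h + 1"
    using off[OF i, of k] off[OF _ j, of k] Vz[of k j] Vz[of i k] i j by auto
qed

lemma graded_band_zero:
  assumes "graded_band n l \<mu> h V" "h \<ge> int n"
  shows "V = 0\<^sub>m n n"
  using assms by (intro eq_matI) (force simp: graded_band_def)+

text \<open>\<open>U\<close> is split into the parts \<open>Um \<mu>\<close>, on which the
  commutator with \<open>J\<close> has the single generalised eigenvalue \<mu>. Their traces against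
  \<open>C\<close> are recurrences with distinct roots and sum zero, so each vanishes, and
  reweighting the parts by \<open>f\<close> keeps the trace zero.\<close>

lemma mtrace_graded:
  fixes J C U :: "'a::field mat" and f :: "'a \<Rightarrow> 'a"
  assumes J: "J \<in> carrier_mat n n" and C: "C \<in> carrier_mat n n" and U: "U \<in> carrier_mat n n"
    and off: "\<And>i j. i < n \<Longrightarrow> j < n \<Longrightarrow> i \<noteq> j \<Longrightarrow> J $$ (i,j) \<noteq> 0 \<Longrightarrow> i < j \<and> J $$ (i,i) = J $$ (j,j)"
    and tr: "\<And>k. mtrace (C * ((\<lambda>V. J * V - V * J) ^^ k) U) = 0"
  shows "mtrace (C * mat n n (\<lambda>(i,j). f (J $$ (i,i) - J $$ (j,j)) * U $$ (i,j))) = 0"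
proof -
  define D where "D = (\<lambda>V. J * V - V * J)"
  define \<Omega> where "\<Omega> = (\<lambda>(i,j). J $$ (i,i) - J $$ (j,j)) ` ({..<n} \<times> {..<n})"
  define Um where "Um = (\<lambda>\<mu>. mat n n (\<lambda>(i,j). if J $$ (i,i) - J $$ (j,j) = \<mu> then U $$ (i,j) else 0))"
  define s where "s = (\<lambda>V k. mtrace (C * (D ^^ k) V))"
  have fin: "finite \<Omega>" by (simp add: \<Omega>_def)
  have DC: "D V \<in> carrier_mat n n" if "V \<in> carrier_mat n n" for V using that J by (auto simp: D_def)
  have DkC: "(D ^^ k) V \<in> carrier_mat n n" if "V \<in> carrier_mat n n" for V k using that by (induction k) (auto simp: DC)
  have Ddiff: "D (V - \<mu> \<cdot>\<^sub>m V') = D V - \<mu> \<cdot>\<^sub>m D V'" if "V \<in> carrier_mat n n" "V' \<in> carrier_mat n n" for V V' \<mu>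
    using that J unfolding D_def
    by (intro eq_matI) (auto simp: scalar_prod_def sum_subtractf sum_distrib_left algebra_simps)
  have Dkdiff: "(D ^^ k) (V - \<mu> \<cdot>\<^sub>m V') = (D ^^ k) V - \<mu> \<cdot>\<^sub>m (D ^^ k) V'"
    if "V \<in> carrier_mat n n" "V' \<in> carrier_mat n n" for V V' \<mu> k
    using that by (induction k) (auto simp: Ddiff DkC)
  have shift: "seq_shift \<mu> (s V) = s (D V - \<mu> \<cdot>\<^sub>m V)" if V: "V \<in> carrier_mat n n" for V \<mu>
  proof
    fix k
    have "s (D V - \<mu> \<cdot>\<^sub>m V) k = mtrace (C * (D ^^ k) (D V) - \<mu> \<cdot>\<^sub>m (C * (D ^^ k) V))"
      unfolding s_def using C V DC[OF V] DkC[OF V, of k] DkC[OF DC[OF V], of k]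
      by (simp add: Dkdiff mult_minus_distrib_mat[of _ n n _ n] mult_smult_distrib[of _ n n _ n])
    also have "\<dots> = s V (Suc k) - \<mu> * s V k"
      using C V DC[OF V] DkC[OF V, of k] DkC[OF DC[OF V], of k]
      by (simp add: mtrace_minus[of _ n] mtrace_smult[of _ n] s_def funpow_swap1)
    finally show "seq_shift \<mu> (s V) k = s (D V - \<mu> \<cdot>\<^sub>m V) k" by (simp add: seq_shift_def)
  qed
  have band: "graded_band n (\<lambda>i. J $$ (i,i)) \<mu> h V \<Longrightarrow> h + int m \<ge> int n \<Longrightarrow> (seq_shift \<mu> ^^ m) (s V) = (\<lambda>k. 0)" for \<mu> h V m
  proof (induction m arbitrary: h V)
    case 0
    hence V: "V = 0\<^sub>m n n" using graded_band_zero[of n _ \<mu> h V] by simp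
    have "(D ^^ k) (0\<^sub>m n n) = 0\<^sub>m n n" for k using J by (induction k) (auto simp: D_def)
    thus ?case using C by (simp add: s_def V mtrace_zero)
  next
    case (Suc m)
    have V: "V \<in> carrier_mat n n" using Suc.prems(1) by (simp add: graded_band_def)
    have "(seq_shift \<mu> ^^ Suc m) (s V) = (seq_shift \<mu> ^^ m) (s (D V - \<mu> \<cdot>\<^sub>m V))"
      using shift[OF V] by (simp add: funpow_swap1)
    also have "\<dots> = (\<lambda>k. 0)"
      using Suc.IH[OF graded_band_step[OF J off Suc.prems(1)]] Suc.prems(2) unfolding D_def by simp
    finally show ?case .
  qed
  have UmC: "Um \<mu> \<in> carrier_mat n n" for \<mu> by (simp add: Um_def)
  \<comment> \<open>Every matrix lies in the band starting at \<open>- int n\<close>, and a band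
    starting at \<open>n\<close> is empty; hence \<open>2*n\<close> steps.\<close>
  have van: "(seq_shift \<mu> ^^ (2*n)) (s (Um \<mu>)) = (\<lambda>k. 0)" for \<mu>
    by (rule band[of \<mu> "- int n"]) (auto simp: graded_band_def Um_def split: if_splits)
  have entry: "(D ^^ k) U $$ (i,j) = (\<Sum>\<mu>\<in>\<Omega>. (D ^^ k) (Um \<mu>) $$ (i,j))" if "i < n" "j < n" for i j k
    using that
  proof (induction k arbitrary: i j)
    case 0
    then have "J $$ (i,i) - J $$ (j,j) \<in> \<Omega>" by (auto simp: \<Omega>_def)
    with 0 show ?case using fin by (simp add: Um_def)
  next
    case (Suc k)
    have "(D ^^ Suc k) V $$ (i,j) = (\<Sum>l<n. J $$ (i,l) * (D ^^ k) V $$ (l,j)) - (\<Sum>l<n. (D ^^ k) V $$ (i,l) * J $$ (l,j))"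
      if "V \<in> carrier_mat n n" for V
      using DkC[OF that, of k] J Suc.prems by (simp add: D_def scalar_prod_def lessThan_atLeast0)
    then show ?case using U UmC Suc
      by (simp add: sum_subtractf sum_distrib_left sum_distrib_right sum.swap[of _ \<Omega>])
  qed
  have trs: "mtrace (C * V) = (\<Sum>i<n. \<Sum>j<n. C $$ (i,j) * V $$ (j,i))" if "V \<in> carrier_mat n n" for V
    using that C by (simp add: mtrace_def scalar_prod_def lessThan_atLeast0)
  have sum0: "(\<Sum>\<mu>\<in>\<Omega>. s (Um \<mu>) k) = 0" for k
  proof -
    have "(\<Sum>\<mu>\<in>\<Omega>. s (Um \<mu>) k) = s U k"
      using U UmC DkC by (simp add: s_def trs entry sum_distrib_left sum.swap[of _ \<Omega>])
    also have "\<dots> = 0" using tr[of k] by (simp add: s_def D_def)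
    finally show ?thesis .
  qed
  have s0: "s (Um \<mu>) 0 = 0" if "\<mu> \<in> \<Omega>" for \<mu>
    by (rule seq_shift_independent[OF fin sum0 van that])
  have "mtrace (C * mat n n (\<lambda>(i,j). f (J $$ (i,i) - J $$ (j,j)) * U $$ (i,j))) = (\<Sum>\<mu>\<in>\<Omega>. f \<mu> * s (Um \<mu>) 0)"
  proof -
    have "f (J $$ (j,j) - J $$ (i,i)) * U $$ (j,i) = (\<Sum>\<mu>\<in>\<Omega>. f \<mu> * Um \<mu> $$ (j,i))" if "i < n" "j < n" for i j
    proof -
      have "J $$ (j,j) - J $$ (i,i) \<in> \<Omega>" using that by (auto simp: \<Omega>_def)
      with that fin show ?thesis by (simp add: Um_def if_distrib cong: if_cong)
    qed
    thus ?thesis using UmC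
      by (simp add: s_def trs sum_distrib_left sum.swap[of _ \<Omega>] mult.left_commute)
  qed
  also have "\<dots> = 0" by (simp add: s0)
  finally show ?thesis .
qed

interpretation to_ac_hom: comm_ring_hom to_ac
  by unfold_locales auto

lemma map_mat_to_ac_zero: "map_mat to_ac (0\<^sub>m n m) = 0\<^sub>m n m"
  by (rule eq_matI) auto

lemma map_mat_to_ac_minus:
  "A \<in> carrier_mat n m \<Longrightarrow> B \<in> carrier_mat n m \<Longrightarrow> map_mat to_ac (A - B) = map_mat to_ac A - map_mat to_ac B"
  by (rule eq_matI) auto

lemma upper_triangular_zero_diag_nilpotent:
  fixes J :: "'a::comm_ring_1 mat"
  assumes J: "J \<in> carrier_mat n n" and ut: "\<And>i j. i < n \<Longrightarrow> j < n \<Longrightarrow> J $$ (i,j) \<noteq> 0 \<Longrightarrow> i < j"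
  shows "J ^\<^sub>m n = 0\<^sub>m n n"
proof -
  have "(J ^\<^sub>m k) $$ (i,j) = 0" if "i < n" "j < n" "j < i + k" for i j k
    using that
  proof (induction k arbitrary: i j)
    case (Suc k)
    have "(J ^\<^sub>m k) $$ (i,l) * J $$ (l,j) = 0" if "l < n" for l
      using Suc.IH[of i l] ut[of l j] Suc.prems that by fastforce
    moreover have "(J ^\<^sub>m Suc k) $$ (i,j) = (\<Sum>l<n. (J ^\<^sub>m k) $$ (i,l) * J $$ (l,j))"
      using J Suc.prems by (simp add: scalar_prod_def lessThan_atLeast0)
    ultimately show ?case by simp
  qed (use J in auto)
  thus ?thesis using J by (intro eq_matI) auto
qed

lemma similar_mat_pow_zero:
  fixes A B :: "'a::comm_ring_1 mat"
  assumes "similar_mat A B" "A \<in> carrier_mat n n" "B ^\<^sub>m k = 0\<^sub>m n n"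
  shows "A ^\<^sub>m k = 0\<^sub>m n n"
proof -
  from assms(1) obtain P Q where w: "similar_mat_wit A B P Q" by (auto simp: similar_mat_def)
  note d = similar_mat_witD2[OF assms(2) w]
  from similar_mat_wit_pow_id[OF w, of k] assms(3) d(6,7) show ?thesis by simp
qed

text \<open>Over the algebraic closure the matrix becomes triangular, and the diagonal of a power of
  a triangular matrix consists of powers of the diagonal entries.\<close>

lemma nilpotent_mtrace_zero:
  fixes A :: "'a::field mat"
  assumes A: "A \<in> carrier_mat n n" and nil: "A ^\<^sub>m k = 0\<^sub>m n n"
  shows "mtrace A = 0"
proof -
  let ?A = "map_mat to_ac A"
  have A': "?A \<in> carrier_mat n n" using A by simp
  from alg_closed_similar_upper_triangular[OF A'] obtain B where
    B: "B \<in> carrier_mat n n" "upper_triangular B" "similar_mat ?A B" by blast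
  have "?A ^\<^sub>m k = 0\<^sub>m n n"
    using to_ac_hom.mat_hom_pow[OF A, of k] nil by (simp add: map_mat_to_ac_zero)
  hence Bk: "B ^\<^sub>m k = 0\<^sub>m n n" using similar_mat_pow_zero[OF similar_mat_sym[OF B(3)] B(1)] by simp
  have diag: "(B ^\<^sub>m j) $$ (i,i) = B $$ (i,i) ^ j \<and> (\<forall>l<i. (B ^\<^sub>m j) $$ (i,l) = 0)" if i: "i < n" for i j
  proof (induction j)
    case (Suc j)
    have e: "(B ^\<^sub>m Suc j) $$ (i,l) = (\<Sum>m<n. (B ^\<^sub>m j) $$ (i,m) * B $$ (m,l))" if "l < n" for l
      using B(1) i that by (simp add: scalar_prod_def lessThan_atLeast0)
    have t: "(B ^\<^sub>m j) $$ (i,m) * B $$ (m,l) = 0" if "m < n" "l < m \<or> m < i" for m l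
      using Suc B(1,2) that by (auto simp: upper_triangular_def)
    have "(\<Sum>m<n. (B ^\<^sub>m j) $$ (i,m) * B $$ (m,i)) = (\<Sum>m<n. if m = i then (B ^\<^sub>m j) $$ (i,i) * B $$ (i,i) else 0)"
      using t[of _ i] by (intro sum.cong) (auto, metis linorder_neqE_nat mult_eq_0_iff)
    moreover have "(\<Sum>m<n. (B ^\<^sub>m j) $$ (i,m) * B $$ (m,l)) = 0" if "l < i" for l
      using t[of _ l] that by (intro sum.neutral) (metis (no_types) lessThan_iff linorder_not_less order_le_less_trans)
    ultimately show ?case using e i Suc by simp
  qed (use B(1) i in auto)
  have "B $$ (i,i) = 0" if "i < n" for i
    using diag[OF that, of k] Bk that by simp
  hence "mtrace B = 0" using B(1) by (simp add: mtrace_def)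
  hence "mtrace ?A = 0" using mtrace_similar[OF B(3)] by simp
  moreover have "mtrace ?A = to_ac (mtrace A)" using A by (simp add: mtrace_def to_ac_sum)
  ultimately show ?thesis by simp
qed

text \<open>The test matrix \<open>Y\<close> acts on each generalised eigenspace of \<open>Z\<close> by a rational-valued additive functional of
  the eigenvalue, so the trace of \<open>ZY\<close> becomes a sum of squares after applying the functional.\<close>

lemma trace_form_zero_nilpotent:
  fixes S :: "'a::field_char_0 mat set"
  assumes S: "S \<subseteq> carrier_mat n n" and Z: "Z \<in> S"
    and closed: "\<And>A B. A \<in> S \<Longrightarrow> B \<in> S \<Longrightarrow> A * B - B * A \<in> S"
    and tr: "\<And>A B. A \<in> S \<Longrightarrow> B \<in> S \<Longrightarrow> mtrace (A * B) = 0"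
    and span: "\<And>Y. Y \<in> carrier_mat n n \<Longrightarrow>
      (\<And>A B. A \<in> S \<Longrightarrow> B \<in> S \<Longrightarrow> mtrace (map_mat to_ac (A * B - B * A) * Y) = 0) \<Longrightarrow>
      mtrace (map_mat to_ac Z * Y) = 0"
  shows "Z ^\<^sub>m n = 0\<^sub>m n n"
proof -
  define h where "h = (map_mat to_ac :: 'a mat \<Rightarrow> 'a alg_closure mat)"
  have hC[simp]: "h A \<in> carrier_mat n n" if "A \<in> S" for A using that S by (auto simp: h_def)
  have hcomm: "h (A * B - B * A) = h A * h B - h B * h A" if "A \<in> S" "B \<in> S" for A B
    using that S
    by (auto simp: h_def to_ac_hom.mat_hom_mult[of _ n n _ n] map_mat_to_ac_minus[of _ n n] mult_carrier_mat[of _ n n _ n] subset_iff)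
  have htr: "mtrace (h A * h B) = 0" if "A \<in> S" "B \<in> S" for A B
  proof -
    have "h A * h B = h (A * B)" using that S by (subst h_def)+ (rule to_ac_hom.mat_hom_mult[symmetric], auto)
    moreover have "mtrace (h M) = to_ac (mtrace M)" if "M \<in> carrier_mat n n" for M
      using that by (simp add: mtrace_def h_def to_ac_sum)
    moreover have "A * B \<in> carrier_mat n n" using that S by (intro mult_carrier_mat[of _ _ n]) auto
    ultimately show ?thesis using tr that by simp
  qed
  from alg_closed_similar_upper_triangular[OF hC[OF Z]] obtain B0 where
    B0: "B0 \<in> carrier_mat n n" "upper_triangular B0" "similar_mat (h Z) B0" by blast
  from triangular_to_jnf_vector[OF B0(1,2)] B0(3) obtain jb where "similar_mat (h Z) (jordan_matrix jb)"
    unfolding jordan_nf_def using similar_mat_trans by blast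
  moreover define J where "J = jordan_matrix jb"
  ultimately obtain P Q where w: "similar_mat_wit (h Z) J P Q" by (auto simp: similar_mat_def)
  note d = similar_mat_witD2[OF hC[OF Z] w]
  note [simp] = d(5-7) mult_carrier_mat[of _ n n _ n] left_mult_one_mat[of _ n n] right_mult_one_mat[of _ n n]
  note assoc = assoc_mult_mat[of _ n n _ n _ n]
  have n: "n = sum_list (map fst jb)" using d(5) by (auto simp: J_def)
  have off: "i < j \<and> J $$ (i,i) = J $$ (j,j)" if "i < n" "j < n" "i \<noteq> j" "J $$ (i,j) \<noteq> 0" for i j
    using jordan_matrix_offdiag[of i jb j] that by (simp add: n J_def)
  have cancel: "P * (Q * M) = M" "Q * (P * M) = M" if "M \<in> carrier_mat n n" for M
    using that d(1,2) assoc[of P Q M] assoc[of Q P M] by auto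
  have QZP: "Q * (h Z * P) = J" using d(1-3) by (simp add: assoc cancel)
  have zero: "J $$ (k,k) = 0" if k: "k < n" for k
  proof (rule ccontr)
    assume "J $$ (k,k) \<noteq> 0"
    from rat_functional_nonzero[OF this] obtain f :: "'a alg_closure \<Rightarrow> rat" where
      fadd: "\<And>x y. f (x + y) = f x + f y" and fsc: "\<And>q x. f (of_rat q * x) = q * f x"
      and fk: "f (J $$ (k,k)) \<noteq> 0" by blast
    have f0: "f 0 = 0" using fadd[of 0 0] by simp
    have fdiff: "f (x - y) = f x - f y" for x y using fadd[of "x - y" y] by simp
    have fsum: "f (sum g I) = (\<Sum>i\<in>I. f (g i))" if "finite I" for g and I :: "nat set"
      using that by (induction I rule: finite_induct) (auto simp: f0 fadd)
    define Y0 where "Y0 = mat n n (\<lambda>(i,j). if i = j then of_rat (f (J $$ (i,i))) else 0 :: 'a alg_closure)"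
    define Y where "Y = P * Y0 * Q"
    have Y0[simp]: "Y0 \<in> carrier_mat n n" by (simp add: Y0_def)
    have Yc[simp]: "Y \<in> carrier_mat n n" by (simp add: Y_def)
    \<comment> \<open>By duality, \<open>span\<close> says that \<open>Z\<close> becomes a
      combination of commutators over the algebraic closure, so a trace against \<open>Y\<close> may
      be tested on commutators.\<close>
    have "mtrace (h Z * Y) = 0" unfolding h_def
    proof (rule span)
      fix A B assume A: "A \<in> S" and B: "B \<in> S"
      note [simp] = hC[OF A] hC[OF B]
      define U where "U = Q * h B * P"
      have U[simp]: "U \<in> carrier_mat n n" by (simp add: U_def)
      define C where "C = Q * h A * P"
      have C[simp]: "C \<in> carrier_mat n n" by (simp add: C_def)
      define ad where "ad = (\<lambda>V. J * V - V * J)"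
      \<comment> \<open>Repeated bracketing with \<open>Z\<close> stays inside \<open>S\<close>, so
        every trace required by \<open>mtrace_graded\<close> is a value of the vanishing trace
        form.\<close>
      have pow: "\<exists>B'\<in>S. (ad ^^ k) U = Q * h B' * P" for k
      proof (induction k)
        case 0 then show ?case using B by (auto simp: U_def)
      next
        case (Suc k)
        then obtain B' where B': "B' \<in> S" "(ad ^^ k) U = Q * h B' * P" by blast
        note [simp] = hC[OF B'(1)] hC[OF Z]
        have "Q * h (Z * B' - B' * Z) * P = Q * (h Z * h B') * P - Q * (h B' * h Z) * P"
          by (simp add: hcomm[OF Z B'(1)] mult_minus_distrib_mat[of _ n n _ n] minus_mult_distrib_mat[of _ n n _ _ n])
        also have "Q * (h Z * h B') * P = J * (Q * h B' * P)"
          by (simp add: QZP[symmetric] assoc cancel)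
        also have "Q * (h B' * h Z) * P = (Q * h B' * P) * J"
          by (simp add: QZP[symmetric] assoc cancel)
        finally have "ad (Q * h B' * P) = Q * h (Z * B' - B' * Z) * P" by (simp add: ad_def)
        hence "(ad ^^ Suc k) U = Q * h (Z * B' - B' * Z) * P" by (simp add: B'(2))
        with closed[OF Z B'(1)] show ?case by blast
      qed
      have tr0: "mtrace (C * (ad ^^ k) U) = 0" for k
      proof -
        from pow[of k] obtain B' where B': "B' \<in> S" "(ad ^^ k) U = Q * h B' * P" by blast
        note [simp] = hC[OF B'(1)]
        have "mtrace (C * (ad ^^ k) U) = mtrace (Q * (h A * h B' * P))"
          by (simp add: B'(2) C_def assoc cancel)
        also have "\<dots> = mtrace (h A * h B')"
          by (subst mtrace_comm[of _ n n]) (simp_all add: assoc d(1))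
        finally show ?thesis using htr[OF A B'(1)] by simp
      qed
      \<comment> \<open>Bracketing with a diagonal matrix multiplies each entry by a difference of
        diagonal entries. Additivity of \<open>f\<close> makes this a function of the eigenvalue
        difference, the kind of reweighting that \<open>mtrace_graded\<close> allows.\<close>
      have UY: "U * Y0 - Y0 * U = mat n n (\<lambda>(i,j). - of_rat (f (J $$ (i,i) - J $$ (j,j))) * U $$ (i,j))"
      proof (rule eq_matI)
        fix i j assume "i < dim_row (mat n n (\<lambda>(i,j). - of_rat (f (J $$ (i,i) - J $$ (j,j))) * U $$ (i,j)))"
          "j < dim_col (mat n n (\<lambda>(i,j). - of_rat (f (J $$ (i,i) - J $$ (j,j))) * U $$ (i,j)))"
        hence ij: "i < n" "j < n" by auto
        have "(U * Y0 - Y0 * U) $$ (i,j) = (\<Sum>l<n. U $$ (i,l) * Y0 $$ (l,j)) - (\<Sum>l<n. Y0 $$ (i,l) * U $$ (l,j))"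
          using ij carrier_matD[OF U] carrier_matD[OF Y0] by (simp add: scalar_prod_def lessThan_atLeast0)
        also have "\<dots> = U $$ (i,j) * of_rat (f (J $$ (j,j))) - of_rat (f (J $$ (i,i))) * U $$ (i,j)"
          using ij by (simp add: Y0_def if_distrib if_distribR cong: if_cong)
        finally show "(U * Y0 - Y0 * U) $$ (i,j) = mat n n (\<lambda>(i,j). - of_rat (f (J $$ (i,i) - J $$ (j,j))) * U $$ (i,j)) $$ (i,j)"
          using ij by (simp add: fdiff of_rat_diff algebra_simps)
      qed (use carrier_matD[OF U] carrier_matD[OF Y0] in auto)
      have hB: "h B = P * U * Q" by (simp add: U_def assoc cancel d(1))
      have "h B * Y - Y * h B = P * (U * Y0 - Y0 * U) * Q"
        by (simp add: hB Y_def assoc cancel mult_minus_distrib_mat[of _ n n _ n] minus_mult_distrib_mat[of _ n n _ _ n])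
      moreover have "mtrace (map_mat to_ac (A * B - B * A) * Y) = mtrace (h A * (h B * Y - Y * h B))"
        unfolding h_def[symmetric] hcomm[OF A B] by (rule mtrace_commutator_mult[of _ n]) simp_all
      moreover have "mtrace (h A * (P * (U * Y0 - Y0 * U) * Q)) = mtrace (C * (U * Y0 - Y0 * U))"
      proof -
        let ?D = "U * Y0 - Y0 * U"
        have D[simp]: "?D \<in> carrier_mat n n" by (intro minus_carrier_mat) simp
        have "mtrace (h A * (P * ?D * Q)) = mtrace ((h A * (P * ?D)) * Q)" by (simp add: assoc)
        also have "\<dots> = mtrace (Q * (h A * (P * ?D)))" by (rule mtrace_comm[of _ n n]) auto
        finally show ?thesis by (simp add: C_def assoc)
      qed
      moreover have "mtrace (C * (U * Y0 - Y0 * U)) = 0"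
        unfolding UY by (rule mtrace_graded[OF d(5) C U off, where f = "\<lambda>x. - of_rat (f x)"])
          (use tr0 in \<open>auto simp: ad_def\<close>)
      ultimately show "mtrace (map_mat to_ac (A * B - B * A) * Y) = 0" by simp
    qed simp
    moreover have "mtrace (h Z * Y) = mtrace (J * Y0)"
    proof -
      have "mtrace (h Z * Y) = mtrace (P * (J * Y0 * Q))" using d(3) by (simp add: Y_def assoc cancel)
      also have "\<dots> = mtrace (J * Y0 * Q * P)" by (rule mtrace_comm[of _ n n]) auto
      finally show ?thesis by (simp add: assoc d(2))
    qed
    moreover have "mtrace (J * Y0) = (\<Sum>i<n. of_rat (f (J $$ (i,i))) * J $$ (i,i))"
      using carrier_matD[OF d(5)] by (simp add: mtrace_def scalar_prod_def Y0_def if_distrib mult.commute lessThan_atLeast0 cong: if_cong)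
    ultimately have "f (\<Sum>i<n. of_rat (f (J $$ (i,i))) * J $$ (i,i)) = 0" by (simp add: f0)
    hence "(\<Sum>i<n. f (J $$ (i,i)) * f (J $$ (i,i))) = 0" by (simp add: fsum fsc)
    hence "f (J $$ (k,k)) * f (J $$ (k,k)) = 0" using k by (subst (asm) sum_nonneg_eq_0_iff) auto
    with fk show False by simp
  qed
  have "J ^\<^sub>m n = 0\<^sub>m n n"
    by (rule upper_triangular_zero_diag_nilpotent[OF d(5)]) (metis off zero)
  hence "h Z ^\<^sub>m n = 0\<^sub>m n n" using w similar_mat_pow_zero[OF _ hC[OF Z]] by (auto simp: similar_mat_def)
  moreover have Xc: "Z \<in> carrier_mat n n" using S Z by auto
  ultimately have "h (Z ^\<^sub>m n) = h (0\<^sub>m n n)" unfolding h_def by (simp add: to_ac_hom.mat_hom_pow map_mat_to_ac_zero)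
  thus ?thesis using Xc by (intro eq_matI) (auto simp: h_def mat_eq_iff)
qed

section \<open>Engel's theorem and Cartan's criterion\<close>

context vector_space
begin

lemma finite_independent_subset_span:
  assumes "finite F" "independent B" "B \<subseteq> span F"
  shows "finite B"
  using independent_span_bound[OF assms] by simp

text \<open>The ambient space may be infinite-dimensional, as for cochains; the finite set
  \<open>F\<close> makes the dimensions honest cardinalities of bases.\<close>

lemma dim_psubset_subspace:
  assumes "subspace A" "subspace C" "A \<subset> C" "C \<subseteq> span F" "finite F"
  shows "dim A < dim C"
proof -
  obtain B where B: "B \<subseteq> A" "independent B" "A \<subseteq> span B" "card B = dim A" using basis_exists[of A] by blast
  obtain D where D: "D \<subseteq> C" "independent D" "C \<subseteq> span D" "card D = dim C" using basis_exists[of C] by blast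
  have finD: "finite D" using finite_independent_subset_span[OF assms(5) D(2)] D(1) assms(4) by blast
  have spB: "span B = A" using B assms(1) by (simp add: span_subspace)
  obtain x where x: "x \<in> C" "x \<notin> A" using assms(3) by blast
  have "independent (insert x B)" using independent_insertI[OF _ B(2)] x spB by simp
  moreover have "insert x B \<subseteq> span D" using x B(1) assms(3) D(3) by blast
  ultimately have "finite (insert x B) \<and> card (insert x B) \<le> card D"
    by (intro independent_span_bound[OF finD])
  moreover have "x \<notin> B" using x B(1) by blast
  moreover have "finite B" using calculation(1) by simp
  ultimately show ?thesis using B(4) D(4) by simp
qed

lemma mem_span_insert_subspace:
  assumes "subspace S"
  shows "z \<in> span (insert y S) \<longleftrightarrow> (\<exists>t\<in>S. \<exists>d. z = t + scale d y)"
proof -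
  have "span S = S" using assms by (simp add: span_eq_iff)
  hence "z \<in> span (insert y S) \<longleftrightarrow> (\<exists>d. z - scale d y \<in> S)" by (simp only: span_breakdown_eq)
  also have "\<dots> \<longleftrightarrow> (\<exists>t\<in>S. \<exists>d. z = t + scale d y)" by (metis add_diff_cancel diff_add_cancel)
  finally show ?thesis .
qed

lemma sum_representation_list:
  assumes "distinct bs" "independent (set bs)" "v \<in> span (set bs)"
  shows "v = (\<Sum>i<length bs. scale (representation (set bs) v (bs ! i)) (bs ! i))"
proof -
  have "(\<Sum>b\<in>set bs. scale (representation (set bs) v b) b) = v"
    using sum_representation_eq[OF assms(2,3), of "set bs"] by simp
  moreover have "(\<Sum>b\<in>set bs. scale (representation (set bs) v b) b)
      = (\<Sum>i<length bs. scale (representation (set bs) v (bs ! i)) (bs ! i))"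
    using assms(1) by (intro sum.reindex_bij_betw[symmetric]) (simp add: bij_betw_nth)
  ultimately show ?thesis by simp
qed

end

section \<open>Matrices of operators restricted to a finite-dimensional subspace\<close>

locale based_subspace = vector_space scale
  for scale :: "'a::field \<Rightarrow> 'b::ab_group_add \<Rightarrow> 'b" +
  fixes bs :: "'b list" and W :: "'b set"
  assumes dist: "distinct bs" and indep: "independent (set bs)" and W: "W = span (set bs)"
begin

text \<open>The basis is a list to give its vectors matrix indices. Only the values of
  \<open>T\<close> on the basis are read, so \<open>T\<close> may be an operator on the ambient
  space; the matrix represents its restriction once \<open>T\<close> preserves
  \<open>W\<close>.\<close>

definition mat_on :: "('b \<Rightarrow> 'b) \<Rightarrow> 'a mat" where
  "mat_on T = mat (length bs) (length bs) (\<lambda>(i,j). representation (set bs) (T (bs ! j)) (bs ! i))"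

lemma mat_on_carrier[simp]: "mat_on T \<in> carrier_mat (length bs) (length bs)"
  by (simp add: mat_on_def)

lemma nth_in_W: "i < length bs \<Longrightarrow> bs ! i \<in> W"
  by (simp add: W span_base)

lemma mat_on_cong:
  "(\<And>v. v \<in> W \<Longrightarrow> T v = S v) \<Longrightarrow> mat_on T = mat_on S"
  unfolding mat_on_def using nth_in_W by (intro eq_matI) auto

lemma mat_on_add:
  assumes "\<And>v. v \<in> W \<Longrightarrow> T v \<in> W" "\<And>v. v \<in> W \<Longrightarrow> S v \<in> W"
  shows "mat_on (\<lambda>v. T v + S v) = mat_on T + mat_on S"
  using assms nth_in_W unfolding mat_on_def W
  by (intro eq_matI) (auto simp: representation_add[OF indep])

lemma mat_on_diff:
  assumes "\<And>v. v \<in> W \<Longrightarrow> T v \<in> W" "\<And>v. v \<in> W \<Longrightarrow> S v \<in> W"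
  shows "mat_on (\<lambda>v. T v - S v) = mat_on T - mat_on S"
  using assms nth_in_W unfolding mat_on_def W
  by (intro eq_matI) (auto simp: representation_diff[OF indep])

lemma mat_on_scale:
  assumes "\<And>v. v \<in> W \<Longrightarrow> T v \<in> W"
  shows "mat_on (\<lambda>v. scale c (T v)) = c \<cdot>\<^sub>m mat_on T"
  using assms nth_in_W unfolding mat_on_def W
  by (intro eq_matI) (auto simp: representation_scale[OF indep])

lemma mat_on_zero: "mat_on (\<lambda>v. 0) = 0\<^sub>m (length bs) (length bs)"
  unfolding mat_on_def by (intro eq_matI) (auto simp: representation_zero)

lemma mat_on_id: "mat_on (\<lambda>v. v) = 1\<^sub>m (length bs)"
  unfolding mat_on_def using dist
  by (intro eq_matI) (auto simp: representation_basis[OF indep] nth_eq_iff_index_eq)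

lemma mat_on_comp:
  assumes T: "Vector_Spaces.linear scale scale T" and TW: "\<And>v. v \<in> W \<Longrightarrow> T v \<in> W" and S: "\<And>v. v \<in> W \<Longrightarrow> S v \<in> W"
  shows "mat_on (\<lambda>v. T (S v)) = mat_on T * mat_on S"
proof (rule eq_matI)
  interpret T: Vector_Spaces.linear scale scale T by fact
  fix i j assume "i < dim_row (mat_on T * mat_on S)" "j < dim_col (mat_on T * mat_on S)"
  hence i: "i < length bs" and j: "j < length bs" by (auto simp: mat_on_def)
  let ?r = "representation (set bs)"
  let ?n = "length bs"
  have Sj: "S (bs ! j) \<in> span (set bs)" using S[OF nth_in_W[OF j]] W by simp
  have Tk: "T (bs ! k) \<in> span (set bs)" if "k < ?n" for k using TW[OF nth_in_W[OF that]] W by simp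
  have "T (S (bs ! j)) = (\<Sum>k<?n. scale (?r (S (bs ! j)) (bs ! k)) (T (bs ! k)))"
    by (subst sum_representation_list[OF dist indep Sj]) (simp add: T.sum T.scale)
  hence "?r (T (S (bs ! j))) (bs ! i) = (\<Sum>k<?n. ?r (S (bs ! j)) (bs ! k) * ?r (T (bs ! k)) (bs ! i))"
    using Tk representation_sum[OF indep, of "{..<?n}" "\<lambda>k. scale (?r (S (bs ! j)) (bs ! k)) (T (bs ! k))", OF span_scale]
    by (simp add: representation_scale[OF indep])
  thus "mat_on (\<lambda>v. T (S v)) $$ (i,j) = (mat_on T * mat_on S) $$ (i,j)"
    using i j by (simp add: mat_on_def scalar_prod_def lessThan_atLeast0 mult.commute)
qed (auto simp: mat_on_def)

lemma mat_on_pow: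
  assumes T: "Vector_Spaces.linear scale scale T" and TW: "\<And>v. v \<in> W \<Longrightarrow> T v \<in> W"
  shows "mat_on (T ^^ k) = mat_on T ^\<^sub>m k"
proof (induction k)
  case 0
  then show ?case using mat_on_id by (simp add: id_def mat_on_def)
next
  case (Suc k)
  have TkW: "(T ^^ k) v \<in> W" if "v \<in> W" for v using that TW by (induction k) auto
  interpret T: Vector_Spaces.linear scale scale T by fact
  have "Vector_Spaces.linear scale scale (T ^^ k)"
  proof (induction k)
    case (Suc k)
    then show ?case using Vector_Spaces.linear_compose[of scale scale "T ^^ k" scale T] T by (simp only: funpow.simps)
  qed (simp only: funpow.simps linear_id)
  hence "mat_on (\<lambda>v. (T ^^ k) (T v)) = mat_on (T ^^ k) * mat_on T" by (rule mat_on_comp) (use TkW TW in auto)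
  thus ?case using Suc by (simp add: funpow_swap1)
qed

lemma mat_on_eq_zero_imp:
  assumes T: "Vector_Spaces.linear scale scale T" and TW: "\<And>v. v \<in> W \<Longrightarrow> T v \<in> W"
    and 0: "mat_on T = 0\<^sub>m (length bs) (length bs)" and v: "v \<in> W"
  shows "T v = 0"
proof -
  interpret T: Vector_Spaces.linear scale scale T by fact
  have "T (bs ! j) = 0" if j: "j < length bs" for j
  proof -
    have "representation (set bs) (T (bs ! j)) (bs ! i) = 0" if "i < length bs" for i
      using arg_cong[OF 0, of "\<lambda>M. M $$ (i,j)"] that j by (simp add: mat_on_def)
    thus ?thesis using sum_representation_list[OF dist indep, of "T (bs ! j)"] TW[OF nth_in_W[OF j]] W by simp
  qed
  hence "T (\<Sum>i<length bs. scale (representation (set bs) v (bs ! i)) (bs ! i)) = 0"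
    by (simp add: T.sum T.scale)
  thus ?thesis using sum_representation_list[OF dist indep, of v] v W by simp
qed

end

section \<open>Leibniz algebras, their representations and Engel's theorem\<close>

locale leibniz = L: finite_dimensional_vector_space sL BL
  for sL :: "'f::field_char_0 \<Rightarrow> 'l::ab_group_add \<Rightarrow> 'l" and BL +
  fixes mult :: "'l \<Rightarrow> 'l \<Rightarrow> 'l" (infixl \<open>\<star>\<close> 70)
  assumes bilin: "bilinear_map sL sL sL mult"
    and leib: "x \<star> (y \<star> z) = (x \<star> y) \<star> z + y \<star> (x \<star> z)"
begin

abbreviation der :: "nat \<Rightarrow> 'l set \<Rightarrow> 'l set" where "der \<equiv> Defs.derived sL mult"

lemma mult_linear_right: "Vector_Spaces.linear sL sL (mult x)"
  using bilin by (simp add: bilinear_map_def)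

lemma mult_linear_left: "Vector_Spaces.linear sL sL (\<lambda>x. x \<star> y)"
  using bilin by (simp add: bilinear_map_def)

sublocale mr: Vector_Spaces.linear sL sL "mult x" for x by (rule mult_linear_right)
sublocale ml: Vector_Spaces.linear sL sL "\<lambda>x. x \<star> y" for y by (rule mult_linear_left)

lemma leib': "(x \<star> y) \<star> z = x \<star> (y \<star> z) - y \<star> (x \<star> z)"
  using leib[of x y z] by simp

lemma derived_Suc_shift: "der (Suc k) S = der k (der 1 S)"
  by (induction k) auto

lemma derived_subset:
  assumes "L.subspace T" "\<And>a b. a \<in> T \<Longrightarrow> b \<in> T \<Longrightarrow> a \<star> b \<in> T"
  shows "der k T \<subseteq> T"
proof (induction k)
  case (Suc k)
  have "{a \<star> b |a b. a \<in> der k T \<and> b \<in> der k T} \<subseteq> T" using Suc assms(2) by auto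
  thus ?case using L.span_minimal[OF _ assms(1)] by simp
qed simp

end

text \<open>Each \<open>rho x\<close> is linear on the whole type, but the laws in the algebra
  variable are imposed on \<open>U\<close> only: for cochains they need multilinearity, and
  \<open>U\<close> will be the space of multilinear functions.\<close>

locale leib_rep = leibniz sL BL mult + V: vector_space sV
  for sL :: "'f::field_char_0 \<Rightarrow> 'l::ab_group_add \<Rightarrow> 'l" and BL and mult :: "'l \<Rightarrow> 'l \<Rightarrow> 'l" (infixl \<open>\<star>\<close> 70)
    and sV :: "'f \<Rightarrow> 'v::ab_group_add \<Rightarrow> 'v" +
  fixes rho :: "'l \<Rightarrow> 'v \<Rightarrow> 'v" and U :: "'v set"
  assumes U: "V.subspace U"
    and rho_linear: "Vector_Spaces.linear sV sV (rho x)"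
    and rho_closed: "u \<in> U \<Longrightarrow> rho x u \<in> U"
    and rho_add_left: "u \<in> U \<Longrightarrow> rho (x + y) u = rho x u + rho y u"
    and rho_scale_left: "u \<in> U \<Longrightarrow> rho (sL c x) u = sV c (rho x u)"
    and rho_mult: "u \<in> U \<Longrightarrow> rho (x \<star> y) u = rho x (rho y u) - rho y (rho x u)"
begin

sublocale rho: Vector_Spaces.linear sV sV "rho x" for x by (rule rho_linear)

lemma rho_zero_left: "u \<in> U \<Longrightarrow> rho 0 u = 0"
  using rho_scale_left[of u 0 0] by simp

lemma rho_sum_left: "u \<in> U \<Longrightarrow> rho (sum f I) u = (\<Sum>i\<in>I. rho (f i) u)"
  by (induction I rule: infinite_finite_induct) (auto simp: rho_zero_left rho_add_left)

lemma rho_minus_left: "u \<in> U \<Longrightarrow> rho (- x) u = - rho x u"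
  using rho_scale_left[of u "-1" x] by simp

lemma rho_diff_left: "u \<in> U \<Longrightarrow> rho (x - y) u = rho x u - rho y u"
  using rho_add_left[of u x "- y"] by (simp add: rho_minus_left)

definition submodule :: "'v set \<Rightarrow> bool" where
  "submodule W \<longleftrightarrow> V.subspace W \<and> W \<subseteq> U \<and> (\<forall>x. \<forall>w\<in>W. rho x w \<in> W)"

text \<open>A square acts by the commutator of an operator with itself. This stands in for passing
  to the quotient Lie algebra.\<close>

lemma Leib_acts_zero:
  assumes "z \<in> Leib sL mult" "u \<in> U"
  shows "rho z u = 0"
proof -
  have "Leib sL mult \<subseteq> {z. rho z u = 0}" unfolding Leib_def
  proof (rule L.span_minimal)
    show "range (\<lambda>x. x \<star> x) \<subseteq> {z. rho z u = 0}" using assms(2) by (auto simp: rho_mult)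
    show "L.subspace {z. rho z u = 0}" using assms(2)
      by (intro L.subspaceI) (auto simp: rho_zero_left rho_add_left rho_scale_left)
  qed
  thus ?thesis using assms(1) by blast
qed

abbreviation word :: "'l list \<Rightarrow> 'v \<Rightarrow> 'v" where "word xs \<equiv> foldr rho xs"

lemma word_zero: "word xs 0 = 0"
  by (induction xs) (auto simp: rho.zero)

lemma word_diff: "word xs (u - v) = word xs u - word xs v"
  by (induction xs) (auto simp: rho.diff)

lemma word_add: "word xs (u + v) = word xs u + word xs v"
  by (induction xs) (auto simp: rho.add)

lemma word_scale: "word xs (sV c u) = sV c (word xs u)"
  by (induction xs) (auto simp: rho.scale)

text \<open>Uniform nilpotency of the associative algebra generated by the operators of
  \<open>T\<close> on \<open>W\<close>.\<close>

definition nil_words :: "nat \<Rightarrow> 'l set \<Rightarrow> 'v set \<Rightarrow> bool" where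
  "nil_words N T W \<longleftrightarrow> (\<forall>xs w. set xs \<subseteq> T \<and> length xs \<ge> N \<and> w \<in> W \<longrightarrow> word xs w = 0)"

context
  fixes W
  assumes W: "submodule W"
begin

lemma W_subspace: "V.subspace W" and W_U: "w \<in> W \<Longrightarrow> w \<in> U" and W_closed: "w \<in> W \<Longrightarrow> rho x w \<in> W"
  using W by (auto simp: submodule_def)

lemma word_closed: "w \<in> W \<Longrightarrow> word xs w \<in> W"
  by (induction xs) (auto simp: W_closed)

text \<open>Expanding the iterated bracket into commutators leaves \<open>rho y\<close> surrounded
  by letters of \<open>T\<close>; of \<open>2 * N\<close> letters at least \<open>N\<close> stand on
  one side.\<close>

lemma word_around_iterated_bracket_zero:
  assumes N: "nil_words N T W" and w: "w \<in> W"
  shows "set us \<subseteq> T \<Longrightarrow> set xs \<subseteq> T \<Longrightarrow> set vs \<subseteq> T \<Longrightarrow> length us + length xs + length vs \<ge> 2 * N \<Longrightarrow>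
    word us (rho (foldr mult xs y) (word vs w)) = 0"
proof (induction xs arbitrary: us vs)
  case Nil
  hence "length us \<ge> N \<or> length vs \<ge> N" by auto
  thus ?case
  proof
    assume "length us \<ge> N"
    thus ?thesis using N Nil w by (auto simp: nil_words_def W_closed word_closed)
  next
    assume "length vs \<ge> N"
    thus ?thesis using N Nil w by (simp add: nil_words_def rho.zero word_zero)
  qed
next
  case (Cons x xs)
  let ?z = "foldr mult xs y"
  have "word us (rho (x \<star> ?z) (word vs w)) = word (us @ [x]) (rho ?z (word vs w)) - word us (rho ?z (word (x # vs) w))"
    using w by (simp add: rho_mult W_U word_closed word_diff)
  also have "\<dots> = 0" using Cons.IH[of "us @ [x]" vs] Cons.IH[of us "x # vs"] Cons.prems by simp
  finally show ?case by simp
qed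

lemma nil_words_insert:
  assumes T: "L.subspace T" and N: "nil_words N T W"
    and y: "\<And>t. t \<in> T \<Longrightarrow> t \<star> y \<in> T"
    and nil: "\<And>w. w \<in> W \<Longrightarrow> (rho y ^^ m) w = 0"
  shows "\<exists>N'. nil_words N' (L.span (insert y T)) W"
proof -
  \<comment> \<open>A descending filtration from \<open>I 0 = W\<close> to \<open>I N = 0\<close>:
    letters of \<open>T\<close> raise the level and \<open>rho y\<close> keeps it.\<close>
  define I where "I = (\<lambda>k. {w \<in> W. \<forall>us. set us \<subseteq> T \<longrightarrow> length us + k \<ge> N \<longrightarrow> word us w = 0})"
  have Isub: "V.subspace (I k)" for k
    unfolding I_def using W_subspace
    by (intro V.subspaceI) (auto simp: V.subspace_0 V.subspace_add V.subspace_scale word_zero word_add word_scale)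
  have ID: "word us w = 0" if "w \<in> I k" "set us \<subseteq> T" "length us + k \<ge> N" for us w k
    using that by (simp add: I_def)
  have Ianti: "w \<in> I k" if "w \<in> I (Suc k)" for w k using that by (auto simp: I_def)
  have IW: "w \<in> W" if "w \<in> I k" for w k using that by (simp add: I_def)
  have t_step: "rho t w \<in> I (Suc k)" if "t \<in> T" "w \<in> I k" for t w k
  proof -
    have "word us (rho t w) = 0" if "set us \<subseteq> T" "length us + Suc k \<ge> N" for us
    proof -
      have "word (us @ [t]) w = 0" using that \<open>t \<in> T\<close> by (intro ID[OF \<open>w \<in> I k\<close>]) auto
      thus ?thesis by simp
    qed
    thus ?thesis using IW[OF that(2)] W_closed by (auto simp: I_def)
  qed
  have y_step: "rho y w \<in> I k" if w: "w \<in> I k" for w k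
  proof -
    \<comment> \<open>Generalised to letters \<open>vs\<close> behind \<open>y\<close>, because
      moving a letter \<open>t\<close> to the right past \<open>y\<close> costs a term with
      \<open>t \<star> y\<close>, which is again a letter of \<open>T\<close>.\<close>
    have "word us (rho y (word vs w)) = 0"
      if "set us \<subseteq> T" "set vs \<subseteq> T" "length us + length vs + k \<ge> N" for us vs
      using that
    proof (induction us arbitrary: vs rule: rev_induct)
      case Nil
      have "word vs w = 0" using Nil by (intro ID[OF w]) auto
      thus ?case by (simp add: rho.zero)
    next
      case (snoc t us)
      let ?w = "word vs w"
      have wU: "?w \<in> U" using IW[OF w] by (simp add: W_U word_closed)
      have "word (us @ [t]) (rho y ?w) = word us (rho t (rho y ?w))" by simp
      also have "rho t (rho y ?w) = rho y (word (t # vs) w) + word ((t \<star> y) # vs) w"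
        using rho_mult[OF wU, of t y] by simp
      also have "word us \<dots> = word us (rho y (word (t # vs) w)) + word (us @ (t \<star> y) # vs) w"
        by (simp add: word_add)
      also have "word us (rho y (word (t # vs) w)) = 0" using snoc by (intro snoc.IH) auto
      also have "word (us @ (t \<star> y) # vs) w = 0" using snoc.prems y by (intro ID[OF w]) auto
      finally show ?case by simp
    qed
    from this[of _ "[]"] show ?thesis using IW[OF w] W_closed by (auto simp: I_def)
  qed
  have yp: "(rho y ^^ j) w \<in> I k" if "w \<in> I k" for w j k using that y_step by (induction j) auto
  \<comment> \<open>Modulo the next level only the \<open>y\<close> parts of the letters survive.
    Since the \<open>m\<close>-th power of \<open>rho y\<close> is zero, \<open>m\<close> letters
    raise the level by one, and \<open>N * m\<close> letters reach zero.\<close>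
  have mod_next: "\<exists>c. word zs w - sV c ((rho y ^^ length zs) w) \<in> I (Suc k)"
    if w: "w \<in> I k" and zs: "set zs \<subseteq> L.span (insert y T)" for zs w k
    using zs
  proof (induction zs)
    case Nil
    show ?case using Isub[of "Suc k"] by (intro exI[of _ 1]) (simp add: V.subspace_0)
  next
    case (Cons z zs)
    then obtain c where c: "word zs w - sV c ((rho y ^^ length zs) w) \<in> I (Suc k)" by auto
    define r where "r = word zs w - sV c ((rho y ^^ length zs) w)"
    define p where "p = (rho y ^^ length zs) w"
    have r: "r \<in> I (Suc k)" and wz: "word zs w = sV c p + r" using c by (auto simp: r_def p_def)
    have p: "p \<in> I k" using yp[OF w] by (simp add: p_def)
    from Cons.prems obtain d t where t: "t \<in> T" and z: "z = t + sL d y"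
      using L.mem_span_insert_subspace[OF T] by auto
    have zact: "rho z u = rho t u + sV d (rho y u)" if "u \<in> W" for u
      using that by (simp add: z W_U rho_add_left rho_scale_left)
    have "word (z # zs) w - sV (c * d) ((rho y ^^ length (z # zs)) w)
        = sV c (rho t p) + (rho t r + sV d (rho y r))"
      using IW[OF p] IW[OF r]
      by (simp add: wz rho.add rho.scale zact p_def[symmetric] V.scale_right_distrib algebra_simps)
    also have "\<dots> \<in> I (Suc k)"
      using t_step[OF t p] Ianti[OF t_step[OF t r]] y_step[OF r] Isub[of "Suc k"]
      by (intro V.subspace_add V.subspace_scale)
    finally show ?case by blast
  qed
  have m_step: "word zs w \<in> I (Suc k)" if w: "w \<in> I k" and zs: "set zs \<subseteq> L.span (insert y T)" "length zs = m" for zs w k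
    using mod_next[OF w zs(1)] zs(2) nil IW[OF w] by auto
  have reach: "word zs w \<in> I k" if "w \<in> W" "set zs \<subseteq> L.span (insert y T)" "length zs \<ge> k * m" for zs w k
    using that
  proof (induction k arbitrary: zs)
    case 0
    thus ?case using N word_closed[OF 0(1), of zs] by (auto simp: I_def nil_words_def)
  next
    case (Suc k)
    let ?n = "length zs - k * m"
    have k: "word (drop ?n zs) w \<in> I k" using Suc by (intro Suc.IH) (auto dest: in_set_dropD)
    define us where "us = take ?n zs"
    have us: "length us \<ge> m" "set us \<subseteq> L.span (insert y T)"
      using Suc.prems by (auto simp: us_def dest: in_set_takeD)
    have eq: "zs = (take (length us - m) us @ drop (length us - m) us) @ drop ?n zs"
      unfolding append_take_drop_id by (simp add: us_def)
    have "word (drop (length us - m) us) (word (drop ?n zs) w) \<in> I (Suc k)"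
      by (rule m_step[OF k]) (use us in \<open>auto dest: in_set_dropD\<close>)
    moreover have "word vs u \<in> I (Suc k)" if "u \<in> I (Suc k)" "set vs \<subseteq> L.span (insert y T)" for u vs
      using that(2)
    proof (induction vs)
      case (Cons z vs)
      then obtain d t where t: "t \<in> T" and z: "z = t + sL d y"
        using L.mem_span_insert_subspace[OF T] by auto
      have IH: "word vs u \<in> I (Suc k)" using Cons by simp
      have "rho z (word vs u) = rho t (word vs u) + sV d (rho y (word vs u))"
        using IW[OF IH] by (simp add: z W_U rho_add_left rho_scale_left)
      also have "\<dots> \<in> I (Suc k)" using Ianti[OF t_step[OF t IH]] y_step[OF IH] Isub[of "Suc k"]
        by (intro V.subspace_add V.subspace_scale)
      finally show ?case by simp
    qed (simp add: that)
    ultimately have "word ((take (length us - m) us @ drop (length us - m) us) @ drop ?n zs) w \<in> I (Suc k)"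
      using us(2) by (auto dest: in_set_takeD simp del: append_take_drop_id)
    thus ?case by (simp only: eq[symmetric])
  qed
  have "nil_words (N * m) (L.span (insert y T)) W" unfolding nil_words_def
  proof (intro allI impI, elim conjE)
    fix zs w assume "set zs \<subseteq> L.span (insert y T)" "N * m \<le> length zs" "w \<in> W"
    from reach[OF this(3,1,2)] have "\<forall>us. set us \<subseteq> T \<longrightarrow> length us + N \<ge> N \<longrightarrow> word us (word zs w) = 0"
      by (simp add: I_def)
    from this[rule_format, of "[]"] show "word zs w = 0" by simp
  qed
  thus ?thesis by blast
qed

text \<open>A subalgebra \<open>T'\<close> grows by one dimension at a time from the kernel
  \<open>K\<close> of the action up to \<open>T\<close>. Keeping \<open>K\<close> inside
  \<open>T'\<close> puts every element of \<open>T\<close> that acts as zero into \<open>T'\<close>;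
  this replaces antisymmetry when the products \<open>y \<star> t\<close> and
  \<open>y \<star> y\<close> are controlled.\<close>

theorem engel:
  assumes T: "L.subspace T" and closed: "\<And>a b. a \<in> T \<Longrightarrow> b \<in> T \<Longrightarrow> a \<star> b \<in> T"
    and nil: "\<And>x w. x \<in> T \<Longrightarrow> w \<in> W \<Longrightarrow> (rho x ^^ m) w = 0"
  shows "\<exists>N. nil_words N T W"
proof -
  define K where "K = {x \<in> T. \<forall>w\<in>W. rho x w = 0}"
  have step: "L.subspace T' \<Longrightarrow> K \<subseteq> T' \<Longrightarrow> T' \<subseteq> T \<Longrightarrow> (\<And>a b. a \<in> T' \<Longrightarrow> b \<in> T' \<Longrightarrow> a \<star> b \<in> T') \<Longrightarrow>
    nil_words N T' W \<Longrightarrow> \<exists>N. nil_words N T W" for T' N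
  proof (induction "L.dim T - L.dim T'" arbitrary: T' N rule: less_induct)
    case less
    show ?case
    proof (cases "T' = T")
      case True
      thus ?thesis using less.prems(5) by blast
    next
      case False
      \<comment> \<open>Otherwise bracketing by elements of \<open>T'\<close> could be continued
        outside \<open>T'\<close> for ever; after \<open>2 * N\<close> brackets the element acts as
        zero and so lies in \<open>K\<close>, hence in \<open>T'\<close>.\<close>
      have "\<exists>y\<in>T - T'. \<forall>t\<in>T'. t \<star> y \<in> T'"
      proof (rule ccontr)
        assume neg: "\<not> ?thesis"
        obtain y0 where y0: "y0 \<in> T - T'" using False less.prems(3) by blast
        have "\<exists>xs. length xs = k \<and> set xs \<subseteq> T' \<and> foldr mult xs y0 \<in> T - T'" for k
        proof (induction k)
          case 0 show ?case using y0 by simp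
        next
          case (Suc k)
          then obtain xs where xs: "length xs = k" "set xs \<subseteq> T'" "foldr mult xs y0 \<in> T - T'" by blast
          with neg obtain t where t: "t \<in> T'" "t \<star> foldr mult xs y0 \<notin> T'" by blast
          have "t \<star> foldr mult xs y0 \<in> T" using closed t(1) xs(3) less.prems(3) by blast
          thus ?case using xs t by (intro exI[of _ "t # xs"]) auto
        qed
        then obtain xs where xs: "length xs = 2 * N" "set xs \<subseteq> T'" "foldr mult xs y0 \<in> T - T'" by blast
        have "rho (foldr mult xs y0) w = 0" if "w \<in> W" for w
          using word_around_iterated_bracket_zero[OF less.prems(5) that, of "[]" xs "[]" y0] xs by simp
        hence "foldr mult xs y0 \<in> K" using xs(3) by (simp add: K_def)
        thus False using xs(3) less.prems(2) by blast
      qed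
      then obtain y where y: "y \<in> T" "y \<notin> T'" and ty: "\<And>t. t \<in> T' \<Longrightarrow> t \<star> y \<in> T'" by blast
      let ?T = "L.span (insert y T')"
      have mem: "z \<in> ?T \<longleftrightarrow> (\<exists>t d. t \<in> T' \<and> z = t + sL d y)" for z
        using L.mem_span_insert_subspace[OF less.prems(1)] by blast
      have inK: "z \<in> T'" if "z \<in> T" "\<And>w. w \<in> W \<Longrightarrow> rho z w = 0" for z
        using that less.prems(2) by (auto simp: K_def)
      have yt: "y \<star> t \<in> T'" if "t \<in> T'" for t
      proof -
        have "y \<star> t + t \<star> y \<in> T'"
        proof (rule inK)
          show "y \<star> t + t \<star> y \<in> T" using closed that y(1) less.prems(3) T by (meson L.subspace_add subsetD)
        qed (simp add: W_U rho_add_left rho_mult)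
        from L.subspace_diff[OF less.prems(1) this ty[OF that]] show ?thesis by simp
      qed
      have yy: "y \<star> y \<in> T'" by (rule inK) (use closed y(1) in \<open>auto simp: W_U rho_mult\<close>)
      have sub: "?T \<subseteq> T" using y(1) less.prems(3) T by (intro L.span_minimal) auto
      have T'sub: "T' \<subset> ?T" using y(2) L.span_superset[of "insert y T'"] by auto
      obtain N' where N': "nil_words N' ?T W"
        using nil_words_insert[OF less.prems(1,5) ty, of m] nil y(1) by blast
      have dim: "L.dim T' < L.dim ?T"
        using L.dim_psubset[of T' "?T"] T'sub less.prems(1) by (simp add: L.span_eq_iff[THEN iffD2])
      have "L.dim ?T \<le> L.dim T" by (rule L.dim_subset[OF sub])
      show ?thesis
      proof (rule less.hyps[of ?T N'])
        show "L.dim T - L.dim ?T < L.dim T - L.dim T'" using dim \<open>L.dim ?T \<le> L.dim T\<close> by linarith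
        show "K \<subseteq> ?T" using less.prems(2) T'sub by blast
        fix a b assume "a \<in> ?T" "b \<in> ?T"
        then obtain s c t d where st: "s \<in> T'" "a = s + sL c y" "t \<in> T'" "b = t + sL d y" using mem by metis
        have "a \<star> b = s \<star> t + sL d (s \<star> y) + (sL c (y \<star> t) + sL c (sL d (y \<star> y)))"
          by (simp add: st mr.add ml.add mr.scale ml.scale L.scale_right_distrib)
        also have "\<dots> \<in> T'" using st ty yt yy less.prems(1,4) by (intro L.subspace_add L.subspace_scale) auto
        finally show "a \<star> b \<in> ?T" using T'sub by blast
      qed (use sub N' in auto)
    qed
  qed
  show ?thesis
  proof (rule step[of K 1])
    show "L.subspace K" using T unfolding K_def
      by (intro L.subspaceI) (auto simp: L.subspace_0 L.subspace_add L.subspace_scale rho_zero_left rho_add_left rho_scale_left W_U)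
    show "a \<star> b \<in> K" if "a \<in> K" "b \<in> K" for a b using that closed by (auto simp: K_def rho_mult W_U rho.zero)
    show "nil_words 1 K W" unfolding nil_words_def
    proof (intro allI impI, elim conjE)
      fix xs w assume "set xs \<subseteq> K" "1 \<le> length xs" "w \<in> W"
      thus "word xs w = 0" by (cases xs) (auto simp: K_def word_closed)
    qed
  qed (auto simp: K_def)
qed

text \<open>An element of the \<open>j\<close>-th derived algebra acts as a combination of words
  with at least \<open>j + 1\<close> letters of \<open>T\<close>: in a bracket of two such elements
  one factor is counted as a single letter.\<close>

lemma nil_words_derived:
  assumes T: "L.subspace T" and closed: "\<And>a b. a \<in> T \<Longrightarrow> b \<in> T \<Longrightarrow> a \<star> b \<in> T" and N: "nil_words N T W"
    and x: "x \<in> der N T" and w: "w \<in> W"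
  shows "rho x w = 0"
proof -
  have "word us (rho x w) = 0" if "x \<in> der j T" "set us \<subseteq> T" "length us + Suc j \<ge> N" for us x j
    using that
  proof (induction j arbitrary: us x)
    case 0
    hence "set (us @ [x]) \<subseteq> T \<and> length (us @ [x]) \<ge> N \<and> w \<in> W" using w by auto
    hence "word (us @ [x]) w = 0" using N unfolding nil_words_def by blast
    thus ?case by simp
  next
    case (Suc j)
    have "der (Suc j) T \<subseteq> {x. word us (rho x w) = 0}"
      unfolding Defs.derived.simps
    proof (rule L.span_minimal)
      show "L.subspace {x. word us (rho x w) = 0}" using W_U[OF w]
        by (intro L.subspaceI) (auto simp: rho_zero_left rho_add_left rho_scale_left word_zero word_add word_scale)
      show "{a \<star> b |a b. a \<in> der j T \<and> b \<in> der j T} \<subseteq> {x. word us (rho x w) = 0}"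
      proof clarify
        fix a b assume ab: "a \<in> der j T" "b \<in> der j T"
        hence abT: "a \<in> T" "b \<in> T" using derived_subset[OF T closed] by blast+
        have "word us (rho (a \<star> b) w) = word (us @ [a]) (rho b w) - word (us @ [b]) (rho a w)"
          using W_U[OF w] by (simp add: rho_mult word_diff)
        also have "\<dots> = 0" using Suc.IH[OF ab(2), of "us @ [a]"] Suc.IH[OF ab(1), of "us @ [b]"] abT Suc.prems by simp
        finally show "word us (rho (a \<star> b) w) = 0" .
      qed
    qed
    thus ?case using Suc.prems(1) by blast
  qed
  from this[OF x, of "[]"] show ?thesis by simp
qed

end
end

section \<open>The trace form of a finite-dimensional module and Cartan's criterion\<close>

locale based_rep = leib_rep sL BL mult sV rho U + B: based_subspace sV bs W
  for sL :: "'f::field_char_0 \<Rightarrow> 'l::ab_group_add \<Rightarrow> 'l" and BL and mult :: "'l \<Rightarrow> 'l \<Rightarrow> 'l" (infixl \<open>\<star>\<close> 70)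
    and sV :: "'f \<Rightarrow> 'v::ab_group_add \<Rightarrow> 'v" and rho U bs W +
  assumes W: "submodule W"
begin

abbreviation rmat :: "'l \<Rightarrow> 'f mat" where "rmat x \<equiv> B.mat_on (rho x)"

definition tform :: "'l \<Rightarrow> 'l \<Rightarrow> 'f" where "tform x y = mtrace (rmat x * rmat y)"

lemmas W_facts = W_subspace[OF W] W_U[OF W] W_closed[OF W]

lemma rmat_add: "rmat (x + y) = rmat x + rmat y"
  using B.mat_on_cong[of "rho (x + y)" "\<lambda>v. rho x v + rho y v"] W_facts(2,3)
  by (simp add: rho_add_left B.mat_on_add)

lemma rmat_scale: "rmat (sL c x) = c \<cdot>\<^sub>m rmat x"
  using B.mat_on_cong[of "rho (sL c x)" "\<lambda>v. sV c (rho x v)"] W_facts(2,3)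
  by (simp add: rho_scale_left B.mat_on_scale)

lemma rmat_mult: "rmat (x \<star> y) = rmat x * rmat y - rmat y * rmat x"
proof -
  have "rmat (x \<star> y) = B.mat_on (\<lambda>v. rho x (rho y v) - rho y (rho x v))"
    by (rule B.mat_on_cong) (simp add: rho_mult W_facts(2))
  also have "\<dots> = B.mat_on (\<lambda>v. rho x (rho y v)) - B.mat_on (\<lambda>v. rho y (rho x v))"
    by (rule B.mat_on_diff) (simp_all add: W_facts(3))
  also have "\<dots> = rmat x * rmat y - rmat y * rmat x"
    using B.mat_on_comp[OF rho_linear W_facts(3) W_facts(3)] by simp
  finally show ?thesis .
qed

lemma rmat_zero_iff: "rmat x = 0\<^sub>m (length bs) (length bs) \<longleftrightarrow> (\<forall>w\<in>W. rho x w = 0)"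
proof
  assume "rmat x = 0\<^sub>m (length bs) (length bs)"
  thus "\<forall>w\<in>W. rho x w = 0" using B.mat_on_eq_zero_imp[OF rho_linear W_facts(3)] by blast
next
  assume "\<forall>w\<in>W. rho x w = 0"
  thus "rmat x = 0\<^sub>m (length bs) (length bs)" using B.mat_on_cong[of "rho x" "\<lambda>_. 0"] by (simp add: B.mat_on_zero)
qed

lemma mult_in_carrier[simp]: "B.mat_on T * B.mat_on S \<in> carrier_mat (length bs) (length bs)"
  by (rule mult_carrier_mat[of _ _ "length bs"]) simp_all

lemma tform_commute: "tform x y = tform y x"
  unfolding tform_def by (rule mtrace_comm[of _ "length bs" "length bs"]) simp_all

lemma tform_add_left: "tform (x + y) z = tform x z + tform y z"
  unfolding tform_def rmat_add
  by (simp add: add_mult_distrib_mat[OF B.mat_on_carrier B.mat_on_carrier B.mat_on_carrier] mtrace_add[of _ "length bs"])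

lemma tform_scale_left: "tform (sL c x) y = c * tform x y"
  unfolding tform_def rmat_scale
  by (simp add: mult_smult_assoc_mat[OF B.mat_on_carrier B.mat_on_carrier] mtrace_smult[of _ "length bs"])

lemma tform_linear_left: "Vector_Spaces.linear sL (*) (\<lambda>x. tform x y)"
  by unfold_locales (auto simp: tform_add_left tform_scale_left algebra_simps)

lemma tform_linear_right: "Vector_Spaces.linear sL (*) (tform x)"
  using tform_linear_left[of x] by (simp add: tform_commute[of _ x])

lemma tform_invariant: "tform (x \<star> y) z = tform x (y \<star> z)"
  unfolding tform_def rmat_mult
  by (rule mtrace_commutator_mult[of _ "length bs"]) simp_all

lemma tform_zero: "(\<And>w. w \<in> W \<Longrightarrow> rho x w = 0) \<Longrightarrow> tform x y = 0"
  unfolding tform_def using rmat_zero_iff[of x] by (simp add: mtrace_zero left_mult_zero_mat[OF B.mat_on_carrier])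

lemma tform_zero_imp_nilpotent:
  assumes S: "L.subspace S" and closed: "\<And>a b. a \<in> S \<Longrightarrow> b \<in> S \<Longrightarrow> a \<star> b \<in> S"
    and tr: "\<And>a b. a \<in> S \<Longrightarrow> b \<in> S \<Longrightarrow> tform a b = 0"
    and x: "x \<in> der 1 S" and w: "w \<in> W"
  shows "(rho x ^^ length bs) w = 0"
proof -
  let ?n = "length bs"
  let ?h = "map_mat to_ac :: 'f mat \<Rightarrow> 'f alg_closure mat"
  have "x \<in> S" using x derived_subset[OF S closed, of 1] by blast
  have tr_hom: "mtrace (?h (rmat (x + y)) * Y) = mtrace (?h (rmat x) * Y) + mtrace (?h (rmat y) * Y)"
    "mtrace (?h (rmat (sL c x)) * Y) = to_ac c * mtrace (?h (rmat x) * Y)"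
    if "Y \<in> carrier_mat ?n ?n" for Y x y c
    using that carrier_matD[OF B.mat_on_carrier]
    by (auto simp: mtrace_def scalar_prod_def rmat_add rmat_scale algebra_simps sum.distrib sum_distrib_left)
  have "rmat x ^\<^sub>m ?n = 0\<^sub>m ?n ?n"
  proof (rule trace_form_zero_nilpotent[of "rmat ` S"])
    show "rmat x \<in> rmat ` S" using \<open>x \<in> S\<close> by blast
    show "A * B - B * A \<in> rmat ` S" if "A \<in> rmat ` S" "B \<in> rmat ` S" for A B
      using that closed by (auto simp: rmat_mult[symmetric])
    show "mtrace (A * B) = 0" if "A \<in> rmat ` S" "B \<in> rmat ` S" for A B
      using that tr by (auto simp: tform_def)
    fix Y :: "'f alg_closure mat" assume Y: "Y \<in> carrier_mat ?n ?n"
      and 0: "\<And>A B. A \<in> rmat ` S \<Longrightarrow> B \<in> rmat ` S \<Longrightarrow> mtrace (?h (A * B - B * A) * Y) = 0"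
    have zero: "mtrace (?h (rmat 0) * Y) = 0" using tr_hom(2)[OF Y, where c = 0 and x = 0] by simp
    \<comment> \<open>For fixed \<open>Y\<close> over the closure, a vanishing trace is a linear
      condition over the ground field, so it passes from brackets to the derived algebra. This
      discharges the duality hypothesis.\<close>
    have "der 1 S \<subseteq> {x. mtrace (?h (rmat x) * Y) = 0}"
      unfolding One_nat_def Defs.derived.simps
      by (rule L.span_minimal, use 0 in \<open>force simp: rmat_mult\<close>)
        (intro L.subspaceI, use zero tr_hom[OF Y] in auto)
    thus "mtrace (?h (rmat x) * Y) = 0" using x by blast
  qed auto
  hence 0: "B.mat_on (rho x ^^ ?n) = 0\<^sub>m ?n ?n"
    using B.mat_on_pow[OF rho_linear W_facts(3), of ?n x] by simp
  have lin: "Vector_Spaces.linear sV sV (rho x ^^ k)" for k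
  proof (induction k)
    case (Suc k)
    then show ?case using Vector_Spaces.linear_compose[of sV sV "rho x ^^ k" sV "rho x"] rho_linear by (simp only: funpow.simps)
  qed (simp only: funpow.simps V.linear_id)
  have "(rho x ^^ k) w \<in> W" if "w \<in> W" for k w using that W_facts(3) by (induction k) auto
  from B.mat_on_eq_zero_imp[OF lin this 0 w] show ?thesis by blast
qed

text \<open>The first derived algebra acts by nilpotent operators, by Engel it generates a nilpotent
  algebra, and so its derived series ends in the kernel of the action. The action may have a kernel,
  so the conclusion concerns operators and not elements.\<close>

theorem cartan:
  assumes S: "L.subspace S" and closed: "\<And>a b. a \<in> S \<Longrightarrow> b \<in> S \<Longrightarrow> a \<star> b \<in> S"
    and tr: "\<And>a b. a \<in> S \<Longrightarrow> b \<in> S \<Longrightarrow> tform a b = 0"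
  shows "\<exists>k. \<forall>x\<in>der k S. \<forall>w\<in>W. rho x w = 0"
proof -
  let ?T = "der 1 S"
  have T: "L.subspace ?T" by (simp add: L.subspace_span)
  have Tclosed: "a \<star> b \<in> ?T" if "a \<in> ?T" "b \<in> ?T" for a b
  proof -
    have "a \<in> S" "b \<in> S" using that derived_subset[OF S closed, of 1] by blast+
    thus ?thesis by (auto intro!: L.span_base)
  qed
  obtain N where N: "nil_words N ?T W"
    using engel[OF W T Tclosed, of "length bs"] tform_zero_imp_nilpotent[OF S closed tr] by blast
  have "\<forall>x\<in>der (Suc N) S. \<forall>w\<in>W. rho x w = 0"
    unfolding derived_Suc_shift[of N] using nil_words_derived[OF W T Tclosed N] by blast
  thus ?thesis by blast
qed

end

section \<open>Casimir operators and Whitehead's lemma\<close>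

context finite_dimensional_vector_space
begin

lemma span_disjoint_independent:
  assumes "independent (A \<union> B)" "A \<inter> B = {}" "x \<in> span A" "x \<in> span B"
  shows "x = 0"
proof -
  have "representation (A \<union> B) x b = 0" for b
  proof (cases "b \<in> A")
    case True
    hence "representation B x b = 0" using assms(2) representation_ne_zero[of B x b] by blast
    thus ?thesis using representation_extend[OF assms(1,4)] by simp
  next
    case False
    hence "representation A x b = 0" using representation_ne_zero[of A x b] by blast
    thus ?thesis using representation_extend[OF assms(1,3)] by simp
  qed
  moreover have "x \<in> span (A \<union> B)" using assms(3) span_mono[of A "A \<union> B"] by blast
  ultimately show ?thesis using sum_nonzero_representation_eq[OF assms(1)] by force
qed

text \<open>The map \<open>T\<close> uses the values \<open>b e x\<close> as coordinates.
  Nondegeneracy makes it injective on the finite-dimensional span, hence onto, and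
  \<open>d e\<close> is a preimage of \<open>e\<close>.\<close>

lemma dual_basis_exists:
  assumes E: "independent E"
    and linl: "\<And>y. Vector_Spaces.linear scale (*) (\<lambda>x. b x y)" and linr: "\<And>x. Vector_Spaces.linear scale (*) (b x)"
    and nondeg: "\<And>x. x \<in> span E \<Longrightarrow> (\<And>e. e \<in> E \<Longrightarrow> b e x = 0) \<Longrightarrow> x = 0"
  shows "\<exists>d. \<forall>e\<in>E. d e \<in> span E \<and> (\<forall>e'\<in>E. b e' (d e) = (if e' = e then 1 else 0))"
proof -
  have fin: "finite E" using finiteI_independent[OF E] .
  define T where "T = (\<lambda>x. \<Sum>e\<in>E. scale (b e x) e)"
  have badd: "b e (x + y) = b e x + b e y" and bsc: "b e (scale c x) = c * b e x" for e x y c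
    using linr[of e] unfolding Vector_Spaces.linear_iff by simp_all
  have lin: "Vector_Spaces.linear scale scale T"
    unfolding T_def Vector_Spaces.linear_iff
    by (auto simp: badd bsc scale_left_distrib sum.distrib scale_sum_right) unfold_locales
  interpret T: Vector_Spaces.linear scale scale T by (rule lin)
  have Tspan: "T x \<in> span E" for x unfolding T_def by (intro span_sum span_scale span_base)
  have coef: "b e x = c e" if "T x = (\<Sum>e\<in>E. scale (c e) e)" "e \<in> E" for e x c
  proof -
    have "(\<Sum>e\<in>E. scale (b e x - c e) e) = 0" using that(1) by (simp add: T_def scale_left_diff_distrib sum_subtractf)
    from independentD[OF E fin subset_refl this that(2)] show ?thesis by simp
  qed
  have inj: "inj_on T (span E)"
    unfolding T.inj_on_iff_eq_0[OF subspace_span]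
  proof (intro ballI impI)
    fix x assume x: "x \<in> span E" "T x = 0"
    have "b e x = 0" if "e \<in> E" for e using coef[of x "\<lambda>_. 0" e] x(2) that by simp
    thus "x = 0" by (rule nondeg[OF x(1)])
  qed
  have ind: "independent (T ` E)" by (rule T.independent_injective_image[OF E inj])
  have "card (T ` E) = card E" using inj_on_subset[OF inj span_superset] by (rule card_image)
  hence "span E \<subseteq> span (T ` E)"
    using card_ge_dim_independent[of "T ` E" "span E"] ind Tspan dim_span_eq_card_independent[OF E] by auto
  hence "\<exists>x\<in>span E. T x = e" if "e \<in> E" for e
    using that span_base[OF that] unfolding T.span_image by blast
  then obtain d where d: "\<And>e. e \<in> E \<Longrightarrow> d e \<in> span E" "\<And>e. e \<in> E \<Longrightarrow> T (d e) = e" by metis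
  have "b e' (d e) = (if e' = e then 1 else 0)" if "e \<in> E" "e' \<in> E" for e e'
  proof (rule coef[of _ "\<lambda>e'. if e' = e then 1 else 0"])
    have "(\<Sum>e'\<in>E. scale (if e' = e then 1 else 0) e') = (\<Sum>e'\<in>E. if e' = e then e' else 0)"
      by (intro sum.cong) auto
    thus "T (d e) = (\<Sum>e'\<in>E. scale (if e' = e then 1 else 0) e')" using d(2) that fin by simp
  qed fact
  thus ?thesis using d(1) by blast
qed

end

section \<open>The Killing form of a semi-simple Leibniz algebra\<close>

locale semisimple_leibniz = leibniz sL BL mult
  for sL :: "'f::field_char_0 \<Rightarrow> 'l::ab_group_add \<Rightarrow> 'l" and BL and mult :: "'l \<Rightarrow> 'l \<Rightarrow> 'l" (infixl \<open>\<star>\<close> 70) +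
  fixes lbs :: "'l list"
  assumes semisimple: "semisimple sL mult" and lbs: "distinct lbs" "set lbs = BL"
begin

text \<open>Left multiplications form a representation by the Leibniz identity, and the trace form
  of this representation is the Killing form.\<close>

sublocale K: based_rep sL BL mult sL mult UNIV lbs UNIV
proof unfold_locales
  interpret K: leib_rep sL BL mult sL mult UNIV
    by unfold_locales (auto simp: ml.add ml.scale leib' mult_linear_right)
  show "K.submodule UNIV" by (simp add: K.submodule_def)
qed (auto simp: ml.add ml.scale leib' lbs L.independent_Basis L.span_Basis)

abbreviation killing :: "'l \<Rightarrow> 'l \<Rightarrow> 'f" where "killing \<equiv> K.tform"
abbreviation Lb :: "'l set" where "Lb \<equiv> Leib sL mult"

lemma Lb_subspace: "L.subspace Lb" by (simp add: Leib_def)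

lemma Lb_left_zero: "z \<in> Lb \<Longrightarrow> z \<star> x = 0"
  using K.Leib_acts_zero by simp

lemma idealD:
  assumes "leib_ideal sL mult I"
  shows "L.subspace I" "y \<in> I \<Longrightarrow> x \<star> y \<in> I" "y \<in> I \<Longrightarrow> y \<star> x \<in> I"
  using assms by (auto simp: leib_ideal_def)

text \<open>Elements that multiply to zero from the left annihilate one another, so one more derived
  step is zero and \<open>I\<close> is solvable. Semisimplicity enters the proof here.\<close>

lemma ideal_subset_Lb:
  assumes I: "leib_ideal sL mult I" and k: "\<And>x w. x \<in> der k I \<Longrightarrow> x \<star> w = 0"
  shows "I \<subseteq> Lb"
proof -
  have "{a \<star> b |a b. a \<in> der k I \<and> b \<in> der k I} \<subseteq> {0}" using k by auto
  hence "der (Suc k) I \<subseteq> {0}" unfolding Defs.derived.simps by (rule L.span_minimal) (rule L.subspace_single_0)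
  moreover have "0 \<in> der (Suc k) I" by (simp add: L.span_zero)
  ultimately have "der (Suc k) I = {0}" by blast
  hence "solvable_ideal sL mult I" using I unfolding solvable_ideal_def by blast
  thus ?thesis using semisimple by (simp add: semisimple_def)
qed

lemma invariant_form_ideal:
  assumes I: "leib_ideal sL mult I" and J: "leib_ideal sL mult J"
    and linr: "\<And>y. Vector_Spaces.linear sL (*) (\<lambda>x. b x y)"
    and comm: "\<And>x y. b x y = b y x" and inv: "\<And>x y z. b (x \<star> y) z = b x (y \<star> z)"
  shows "leib_ideal sL mult {x \<in> J. \<forall>y\<in>I. b x y = 0}"
  unfolding leib_ideal_def
proof (intro conjI allI impI)
  have badd: "b (x + y) z = b x z + b y z" and bsc: "b (sL c x) z = c * b x z" for x y z c
    using linr[of z] unfolding Vector_Spaces.linear_iff by simp_all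
  have "b 0 z = 0" for z using bsc[of 0 0 z] by simp
  thus "L.subspace {x \<in> J. \<forall>y\<in>I. b x y = 0}" using idealD(1)[OF J]
    by (intro L.subspaceI) (auto simp: badd bsc L.subspace_0 L.subspace_add L.subspace_scale)
  fix x y assume y: "y \<in> {x \<in> J. \<forall>y\<in>I. b x y = 0}"
  have "b (x \<star> y) i = 0" if "i \<in> I" for i
  proof -
    have "b (x \<star> y) i = b (i \<star> x) y" unfolding inv[of i x y] by (rule comm)
    also have "\<dots> = b y (i \<star> x)" by (rule comm)
    finally show ?thesis using y idealD(3)[OF I that] by simp
  qed
  thus "x \<star> y \<in> {x \<in> J. \<forall>y\<in>I. b x y = 0}" using y idealD(2)[OF J] by simp
  show "y \<star> x \<in> {x \<in> J. \<forall>y\<in>I. b x y = 0}" using y idealD(3)[OF J] idealD(2)[OF I] by (simp add: inv)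
qed

lemma UNIV_ideal: "leib_ideal sL mult UNIV"
  by (simp add: leib_ideal_def)

text \<open>The radical is an ideal on which the form vanishes, so by Cartan's criterion its derived
  series ends in elements with zero left multiplication. Conversely, \<open>Leib\<close> has zero
  left multiplication.\<close>

lemma killing_radical: "(\<forall>y. killing x y = 0) \<longleftrightarrow> x \<in> Lb"
proof
  let ?R = "{x \<in> UNIV. \<forall>y\<in>UNIV. killing x y = 0}"
  have R: "leib_ideal sL mult ?R"
    by (rule invariant_form_ideal[OF UNIV_ideal UNIV_ideal K.tform_linear_left K.tform_commute K.tform_invariant])
  have "\<exists>k. \<forall>x\<in>der k ?R. \<forall>w\<in>UNIV. x \<star> w = 0"
    by (rule K.cartan) (use idealD[OF R] in auto)
  hence "?R \<subseteq> Lb" using ideal_subset_Lb[OF R] by blast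
  moreover assume "\<forall>y. killing x y = 0"
  ultimately show "x \<in> Lb" by auto
next
  assume "x \<in> Lb"
  thus "\<forall>y. killing x y = 0" using K.tform_zero[of x] Lb_left_zero by simp
qed

text \<open>The Killing form is nondegenerate on a complement of \<open>Leib\<close>. With bases
  adapted to \<open>Leib\<close> and \<open>P\<close>, the dual vector of a basis element outside
  \<open>P\<close> is orthogonal to \<open>P\<close>, and it is not in \<open>Leib\<close> because
  it pairs to 1 with that element.\<close>

lemma exists_killing_orthogonal:
  assumes P: "L.subspace P" and LbP: "Lb \<subseteq> P" and "P \<noteq> UNIV"
  shows "\<exists>z. z \<notin> Lb \<and> (\<forall>p\<in>P. killing z p = 0)"
proof -
  obtain B0 where B0: "B0 \<subseteq> Lb" "L.independent B0" "Lb \<subseteq> L.span B0" by (rule L.maximal_independent_subset)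
  obtain B1 where B1: "B0 \<subseteq> B1" "B1 \<subseteq> P" "L.independent B1" "P \<subseteq> L.span B1"
    by (rule L.maximal_independent_subset_extend[OF order_trans[OF B0(1) LbP] B0(2)])
  obtain B2 where B2: "B1 \<subseteq> B2" "L.independent B2" "UNIV \<subseteq> L.span B2"
    by (rule L.maximal_independent_subset_extend[OF subset_UNIV B1(3)])
  have spB0: "L.span B0 = Lb" using B0 Lb_subspace by (simp add: L.span_subspace)
  have spB1: "L.span B1 = P" using B1 P by (simp add: L.span_subspace)
  define E where "E = B2 - B0"
  have E: "L.independent E" using B2(2) L.dependent_mono[of E B2] by (auto simp: E_def)
  have LbK: "killing x z = 0" "killing z x = 0" if "z \<in> Lb" for x z
    using killing_radical[of z] that K.tform_commute by auto
  have "\<exists>d. \<forall>e\<in>E. d e \<in> L.span E \<and> (\<forall>e'\<in>E. killing e' (d e) = (if e' = e then 1 else 0))"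
  proof (rule L.dual_basis_exists[OF E K.tform_linear_left K.tform_linear_right])
    fix x assume x: "x \<in> L.span E" "\<And>e. e \<in> E \<Longrightarrow> killing e x = 0"
    have "killing y x = 0" if "y \<in> B2" for y
      using that x(2)[of y] B0(1) LbK by (cases "y \<in> B0") (auto simp: E_def)
    hence "B2 \<subseteq> {y. killing y x = 0}" by blast
    moreover have "L.subspace {y. killing y x = 0}"
      by (intro L.subspaceI) (auto simp: K.tform_add_left K.tform_scale_left LbK L.subspace_0[OF Lb_subspace])
    ultimately have "\<forall>y. killing y x = 0" using L.span_minimal[of B2] B2(3) by blast
    hence "\<forall>y. killing x y = 0" unfolding K.tform_commute[of x] .
    hence "x \<in> L.span B0" using killing_radical[of x] spB0 by simp
    thus "x = 0" using L.span_disjoint_independent[of E B0 x] x(1) B2(2) B2(1) B1(1)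
      by (metis Diff_disjoint E_def Int_commute Un_Diff_cancel2 Un_absorb2 order_trans)
  qed
  then obtain d where d: "\<And>e e'. e \<in> E \<Longrightarrow> e' \<in> E \<Longrightarrow> killing e' (d e) = (if e' = e then 1 else 0)" by blast
  obtain e where e: "e \<in> B2" "e \<notin> B1" proof -
    have "\<not> B2 \<subseteq> B1"
    proof
      assume "B2 \<subseteq> B1"
      hence "UNIV \<subseteq> P" using B2(3) L.span_mono[of B2 B1] spB1 by (metis order_trans)
      thus False using assms(3) by (simp add: top.extremum_unique)
    qed
    thus thesis using that by (meson subsetI)
  qed
  hence eE: "e \<in> E" using B1(1) by (auto simp: E_def)
  have "B1 \<subseteq> {p. killing (d e) p = 0}"
  proof
    fix p assume p: "p \<in> B1"
    show "p \<in> {p. killing (d e) p = 0}"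
    proof (cases "p \<in> B0")
      case True thus ?thesis using B0(1) LbK by blast
    next
      case False
      hence "p \<in> E" using p B2(1) by (auto simp: E_def)
      thus ?thesis using d[OF eE] p e(2) K.tform_commute[of "d e" p] by auto
    qed
  qed
  moreover have "L.subspace {p. killing (d e) p = 0}"
    by (intro L.subspaceI) (auto simp: K.tform_commute[of "d e"] K.tform_add_left K.tform_scale_left LbK L.subspace_0[OF Lb_subspace])
  ultimately have "\<forall>p\<in>P. killing (d e) p = 0" using L.span_minimal[of B1] spB1 by blast
  moreover have "d e \<notin> Lb" using d[OF eE eE] LbK by auto
  ultimately show ?thesis by blast
qed

text \<open>Perfectness modulo \<open>Leib\<close>. If \<open>z\<close> is orthogonal to all
  products, invariance puts every product with \<open>z\<close> into the radical, so
  \<open>z\<close> and \<open>Leib\<close> span a solvable ideal.\<close>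

lemma products_span: "L.span ({x \<star> y |x y. True} \<union> Lb) = UNIV"
proof (rule ccontr)
  let ?P = "L.span ({x \<star> y |x y. True} \<union> Lb)"
  assume "?P \<noteq> UNIV"
  from exists_killing_orthogonal[OF L.subspace_span _ this] obtain z where
    z: "z \<notin> Lb" "\<And>p. p \<in> ?P \<Longrightarrow> killing z p = 0" using L.span_superset by blast
  have zx: "z \<star> x \<in> Lb" for x
  proof -
    have "killing (z \<star> x) y = 0" for y
      using z(2)[of "x \<star> y"] by (auto simp: K.tform_invariant intro!: L.span_base)
    thus ?thesis using killing_radical by blast
  qed
  have xz: "x \<star> z \<in> Lb" for x
  proof -
    have "killing (x \<star> z) y = 0" for y
    proof -
      have "killing (x \<star> z) y = killing (y \<star> x) z"
        unfolding K.tform_invariant[of y x z] by (rule K.tform_commute)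
      also have "\<dots> = killing z (y \<star> x)" by (rule K.tform_commute)
      finally show ?thesis using z(2)[of "y \<star> x"] by (auto intro!: L.span_base)
    qed
    thus ?thesis using killing_radical by blast
  qed
  have LbL: "x \<star> l \<in> Lb" "l \<star> x \<in> Lb" if "l \<in> Lb" for x l
  proof -
    show "l \<star> x \<in> Lb" using Lb_left_zero[OF that] L.subspace_0[OF Lb_subspace] by simp
    have "killing (x \<star> l) y = 0" for y
    proof -
      have "killing (x \<star> l) y = killing (y \<star> x) l" unfolding K.tform_invariant[of y x l] by (rule K.tform_commute)
      also have "\<dots> = killing l (y \<star> x)" by (rule K.tform_commute)
      finally show ?thesis using that killing_radical[of l] by simp
    qed
    thus "x \<star> l \<in> Lb" using killing_radical by blast
  qed
  let ?I = "L.span (insert z Lb)"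
  note mem = L.mem_span_insert_subspace[OF Lb_subspace, of _ z]
  have prod: "a \<star> b \<in> Lb" if "a \<in> ?I \<or> b \<in> ?I" for a b
    using that
  proof
    assume "a \<in> ?I"
    then obtain t c where "t \<in> Lb" "a = t + sL c z" using mem by blast
    thus ?thesis using zx LbL(2) Lb_subspace by (auto simp: ml.add ml.scale intro: L.subspace_add L.subspace_scale)
  next
    assume "b \<in> ?I"
    then obtain t c where "t \<in> Lb" "b = t + sL c z" using mem by blast
    thus ?thesis using xz LbL(1) Lb_subspace by (auto simp: mr.add mr.scale intro: L.subspace_add L.subspace_scale)
  qed
  have LbI: "Lb \<subseteq> ?I" "z \<in> ?I" using L.span_superset[of "insert z Lb"] by auto
  have "leib_ideal sL mult ?I" unfolding leib_ideal_def using prod LbI(1) by (auto simp: L.subspace_span)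
  moreover have "x \<star> w = 0" if "x \<in> der 1 ?I" for x w
  proof -
    have "der 1 ?I \<subseteq> Lb" unfolding One_nat_def Defs.derived.simps
      by (rule L.span_minimal[OF _ Lb_subspace]) (use prod in auto)
    thus ?thesis using that Lb_left_zero by blast
  qed
  ultimately have "?I \<subseteq> Lb" by (rule ideal_subset_Lb)
  thus False using LbI(2) z(1) by blast
qed

end

locale semisimple_rep = semisimple_leibniz sL BL mult lbs + leib_rep sL BL mult sV rho U
  for sL :: "'f::field_char_0 \<Rightarrow> 'l::ab_group_add \<Rightarrow> 'l" and BL and mult :: "'l \<Rightarrow> 'l \<Rightarrow> 'l" (infixl \<open>\<star>\<close> 70)
    and lbs and sV :: "'f \<Rightarrow> 'v::ab_group_add \<Rightarrow> 'v" and rho U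
begin

text \<open>Products act by commutators of double actions, and products together with
  \<open>Leib\<close> span the algebra. This settles Whitehead's lemma for a submodule with trivial
  action.\<close>

lemma double_action_zero_imp:
  assumes u: "u \<in> U" and 0: "\<And>x y. rho x (rho y u) = 0"
  shows "rho x u = 0"
proof -
  have "L.subspace {x. rho x u = 0}" using u
    by (intro L.subspaceI) (auto simp: rho_zero_left rho_add_left rho_scale_left)
  moreover have "{x \<star> y |x y. True} \<union> Lb \<subseteq> {x. rho x u = 0}"
    using u 0 Leib_acts_zero[OF _ u] by (auto simp: rho_mult)
  ultimately show ?thesis using L.span_minimal products_span by blast
qed

end

section \<open>The ideal complementary to the kernel of a module, and the Casimir operator\<close>

locale semisimple_based_rep = semisimple_rep sL BL mult lbs sV rho U + based_rep sL BL mult sV rho U bs W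
  for sL :: "'f::field_char_0 \<Rightarrow> 'l::ab_group_add \<Rightarrow> 'l" and BL and mult :: "'l \<Rightarrow> 'l \<Rightarrow> 'l" (infixl \<open>\<star>\<close> 70)
    and lbs and sV :: "'f \<Rightarrow> 'v::ab_group_add \<Rightarrow> 'v" and rho U bs W
begin

definition act_kernel :: "'l set" where "act_kernel = {x. \<forall>w\<in>W. rho x w = 0}"

text \<open>The ideal on which the action on \<open>W\<close> is faithful modulo
  \<open>Leib\<close>. The condition \<open>x \<in> UNIV\<close> matches the shape of
  \<open>invariant_form_ideal\<close>.\<close>

definition complement :: "'l set" where "complement = {x \<in> UNIV. \<forall>y\<in>act_kernel. killing x y = 0}"

lemma act_kernel_ideal: "leib_ideal sL mult act_kernel"
  unfolding leib_ideal_def act_kernel_def using W_facts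
  by (auto intro!: L.subspaceI simp: rho_zero_left rho_add_left rho_scale_left rho_mult rho.zero)

lemma complement_ideal: "leib_ideal sL mult complement"
  unfolding complement_def
  by (rule invariant_form_ideal[OF act_kernel_ideal UNIV_ideal K.tform_linear_left K.tform_commute K.tform_invariant])

lemma Lb_subset_complement: "Lb \<subseteq> complement"
  using killing_radical by (auto simp: complement_def)

text \<open>By invariance a product of a kernel element with a complement element is
  Killing-orthogonal to everything, so it lies in \<open>Leib\<close> and multiplies to zero; the
  intersection is a solvable ideal.\<close>

lemma act_kernel_Int_complement: "act_kernel \<inter> complement \<subseteq> Lb"
proof (rule ideal_subset_Lb)
  show "leib_ideal sL mult (act_kernel \<inter> complement)"
    using idealD[OF act_kernel_ideal] idealD[OF complement_ideal] unfolding leib_ideal_def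
    by (auto intro: L.subspace_inter)
  fix x w assume x: "x \<in> der 1 (act_kernel \<inter> complement)"
  have "a \<star> b \<in> Lb" if "a \<in> act_kernel" "b \<in> complement" for a b
  proof -
    have "killing (a \<star> b) z = 0" for z
    proof -
      have "b \<star> z \<in> complement" using idealD(3)[OF complement_ideal that(2)] .
      hence "killing (b \<star> z) a = 0" using that(1) by (simp add: complement_def)
      thus ?thesis using K.tform_invariant[of a b z] K.tform_commute[of a "b \<star> z"] by simp
    qed
    thus ?thesis using killing_radical by blast
  qed
  hence "der 1 (act_kernel \<inter> complement) \<subseteq> Lb"
    unfolding One_nat_def Defs.derived.simps by (intro L.span_minimal[OF _ Lb_subspace]) auto
  thus "x \<star> w = 0" using x Lb_left_zero by blast
qed

text \<open>Cartan's criterion sends the derived series of the radical into the kernel of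
  \<open>W\<close>, while the series also stays in the complement. The two meet inside
  \<open>Leib\<close>, so the radical is solvable.\<close>

lemma tform_radical_complement:
  assumes "x \<in> complement" "\<And>y. y \<in> complement \<Longrightarrow> tform x y = 0"
  shows "x \<in> Lb"
proof -
  let ?R = "{x \<in> complement. \<forall>y\<in>complement. tform x y = 0}"
  have R: "leib_ideal sL mult ?R"
    by (rule invariant_form_ideal[OF complement_ideal complement_ideal tform_linear_left tform_commute tform_invariant])
  have "\<exists>k. \<forall>x\<in>der k ?R. \<forall>w\<in>W. rho x w = 0"
    by (rule cartan) (use idealD[OF R] in auto)
  then obtain k where k: "der k ?R \<subseteq> act_kernel" by (auto simp: act_kernel_def)
  have "der k ?R \<subseteq> ?R" by (rule derived_subset) (use idealD[OF R] in auto)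
  hence "der k ?R \<subseteq> Lb" using k act_kernel_Int_complement by blast
  hence "?R \<subseteq> Lb" using Lb_left_zero by (intro ideal_subset_Lb[OF R, of k]) blast
  thus ?thesis using assms by blast
qed

lemma mtrace_mat_on_sum:
  assumes "finite I" "\<And>i v. i \<in> I \<Longrightarrow> v \<in> W \<Longrightarrow> T i v \<in> W"
  shows "mtrace (B.mat_on (\<lambda>v. \<Sum>i\<in>I. T i v)) = (\<Sum>i\<in>I. mtrace (B.mat_on (T i)))"
  using assms
proof (induction I rule: finite_induct)
  case empty
  then show ?case by (simp add: B.mat_on_zero mtrace_zero)
next
  case (insert j I)
  have "B.mat_on (\<lambda>v. T j v + (\<Sum>i\<in>I. T i v)) = B.mat_on (T j) + B.mat_on (\<lambda>v. \<Sum>i\<in>I. T i v)"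
    by (rule B.mat_on_add) (use insert.prems W_facts(1) in \<open>auto intro: V.subspace_sum\<close>)
  then show ?case using insert by (simp add: mtrace_add[OF B.mat_on_carrier B.mat_on_carrier])
qed

text \<open>The Casimir operator is formed from dual bases, with respect to the trace form of \<open>W\<close>, of a complement
  of \<open>Leib\<close> in the Killing-orthogonal of the kernel of \<open>W\<close>. Taking the ideal rather than a
  quotient by the kernel lets it act, and commute with the action, on all of \<open>U\<close>.\<close>

theorem casimir_exists:
  assumes nontriv: "\<exists>x. \<exists>w\<in>W. rho x w \<noteq> 0"
  shows "\<exists>c. Vector_Spaces.linear sV sV c \<and> (\<forall>x. \<forall>u\<in>U. c (rho x u) = rho x (c u)) \<and>
    (\<forall>W' u. submodule W' \<and> u \<in> U \<and> (\<forall>x. rho x u \<in> W') \<longrightarrow> c u \<in> W') \<and>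
    (\<forall>m. \<exists>w\<in>W. (c ^^ m) w \<noteq> 0)"
proof -
  let ?J = complement
  obtain B0 where B0: "B0 \<subseteq> Lb" "L.independent B0" "Lb \<subseteq> L.span B0" by (rule L.maximal_independent_subset)
  obtain B1 where B1: "B0 \<subseteq> B1" "B1 \<subseteq> ?J" "L.independent B1" "?J \<subseteq> L.span B1"
    by (rule L.maximal_independent_subset_extend[OF order_trans[OF B0(1) Lb_subset_complement] B0(2)])
  have spB0: "L.span B0 = Lb" using B0 Lb_subspace by (simp add: L.span_subspace)
  have spB1: "L.span B1 = ?J" using B1 idealD(1)[OF complement_ideal] by (simp add: L.span_subspace)
  define E where "E = B1 - B0"
  have E: "L.independent E" using B1(3) L.dependent_mono[of E B1] by (auto simp: E_def)
  have fin: "finite E" using L.finiteI_independent[OF E] .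
  have spE: "L.span E \<subseteq> ?J" using spB1 L.span_mono[of E B1] by (auto simp: E_def)
  have LbT: "tform x z = 0" "tform z x = 0" if "z \<in> Lb" for x z
    using tform_zero[of z x] Leib_acts_zero[OF that] W_facts(2) tform_commute[of x z] by auto
  have tadd: "tform x (y + z) = tform x y + tform x z" and tsc: "tform x (sL c y) = c * tform x y" for x y z c
    by (simp_all add: tform_commute[of x] tform_add_left tform_scale_left)
  have onJ: "tform y x = 0" if "\<And>e. e \<in> E \<Longrightarrow> tform e x = 0" "y \<in> ?J" for x y
  proof -
    have "tform y x = 0" if "y \<in> B1" for y
      using that \<open>\<And>e. e \<in> E \<Longrightarrow> tform e x = 0\<close>[of y] B0(1) LbT by (cases "y \<in> B0") (auto simp: E_def)
    hence "B1 \<subseteq> {y. tform y x = 0}" by blast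
    moreover have "L.subspace {y. tform y x = 0}"
      by (intro L.subspaceI) (auto simp: tform_add_left tform_scale_left LbT L.subspace_0[OF Lb_subspace])
    ultimately show ?thesis using L.span_minimal[of B1] spB1 that(2) by blast
  qed
  have "\<exists>d. \<forall>e\<in>E. d e \<in> L.span E \<and> (\<forall>e'\<in>E. tform e' (d e) = (if e' = e then 1 else 0))"
  proof (rule L.dual_basis_exists[OF E tform_linear_left tform_linear_right])
    fix x assume x: "x \<in> L.span E" "\<And>e. e \<in> E \<Longrightarrow> tform e x = 0"
    have "tform x y = 0" if "y \<in> ?J" for y using onJ[OF x(2) that] by (simp add: tform_commute[of x])
    hence "x \<in> Lb" using x(1) spE by (intro tform_radical_complement) auto
    hence "x \<in> L.span B0" using spB0 by simp
    thus "x = 0" using L.span_disjoint_independent[of E B0 x] x(1) B1(1,3)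
      by (metis Diff_disjoint E_def Int_commute Un_Diff_cancel2 Un_absorb2)
  qed
  then obtain d where dE: "\<And>e. e \<in> E \<Longrightarrow> d e \<in> L.span E"
    and d: "\<And>e e'. e \<in> E \<Longrightarrow> e' \<in> E \<Longrightarrow> tform e' (d e) = (if e' = e then 1 else 0)" by blast
  have EJ: "e \<in> ?J" if "e \<in> E" for e using that B1(2) by (auto simp: E_def)
  have dJ: "d e \<in> ?J" if "e \<in> E" for e using dE[OF that] spE by blast
  have tsum: "tform x (sum f E) = (\<Sum>e\<in>E. tform x (f e))" for x f
    using fin by (induction E rule: finite_induct) (auto simp: tadd LbT L.subspace_0[OF Lb_subspace])
  have tdiff: "tform x (y - z) = tform x y - tform x z" for x y z
    using tadd[of x "y - z" z] by simp
  \<comment> \<open>Expansion in the dual basis holds only modulo \<open>Leib\<close>. That is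
    enough for the action, since \<open>Leib\<close> acts as zero on all of \<open>U\<close> and not
    merely on \<open>W\<close>.\<close>
  have exp_d: "y - (\<Sum>e\<in>E. sL (tform e y) (d e)) \<in> Lb" if y: "y \<in> ?J" for y
  proof (rule tform_radical_complement)
    show J: "y - (\<Sum>e\<in>E. sL (tform e y) (d e)) \<in> ?J"
      using idealD(1)[OF complement_ideal] y dJ
      by (intro L.subspace_diff L.subspace_sum L.subspace_scale) auto
    fix z assume z: "z \<in> ?J"
    have "tform e (y - (\<Sum>e\<in>E. sL (tform e y) (d e))) = 0" if e: "e \<in> E" for e
    proof -
      have "(\<Sum>e'\<in>E. tform e' y * tform e (d e')) = (\<Sum>e'\<in>E. if e' = e then tform e y else 0)"
        by (intro sum.cong) (auto simp: d e)
      thus ?thesis using e fin by (simp add: tdiff tsum tsc)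
    qed
    from onJ[OF this z] show "tform (y - (\<Sum>e\<in>E. sL (tform e y) (d e))) z = 0" by (simp add: tform_commute[of _ z])
  qed
  have act_d: "rho y u = (\<Sum>e\<in>E. sV (tform e y) (rho (d e) u))" if "y \<in> ?J" "u \<in> U" for y u
    using Leib_acts_zero[OF exp_d[OF that(1)] that(2)] that(2)
    by (simp add: rho_diff_left rho_sum_left rho_scale_left)
  have exp_e: "y - (\<Sum>e\<in>E. sL (tform y (d e)) e) \<in> Lb" if y: "y \<in> ?J" for y
  proof (rule tform_radical_complement)
    let ?y = "y - (\<Sum>e\<in>E. sL (tform y (d e)) e)"
    show J: "?y \<in> ?J"
      using idealD(1)[OF complement_ideal] y EJ
      by (intro L.subspace_diff L.subspace_sum L.subspace_scale) auto
    fix z assume z: "z \<in> ?J"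
    have yd: "tform ?y (d e) = 0" if e: "e \<in> E" for e
    proof -
      have "tform (d e) ?y = tform (d e) y - (\<Sum>e'\<in>E. tform y (d e') * tform (d e) e')"
        by (simp add: tdiff tsum tsc)
      also have "(\<Sum>e'\<in>E. tform y (d e') * tform (d e) e') = (\<Sum>e'\<in>E. if e' = e then tform y (d e) else 0)"
        by (intro sum.cong) (auto simp: d e tform_commute[of "d e"])
      finally show ?thesis using e fin by (simp add: tform_commute[of "d e"])
    qed
    have "tform ?y z = tform ?y (z - (\<Sum>e\<in>E. sL (tform e z) (d e))) + tform ?y (\<Sum>e\<in>E. sL (tform e z) (d e))"
      by (simp only: tadd[symmetric]) simp
    also have "\<dots> = 0" using LbT(1)[OF exp_d[OF z]] yd by (simp add: tsum tsc)
    finally show "tform ?y z = 0" .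
  qed
  have act_e: "rho y u = (\<Sum>e\<in>E. sV (tform y (d e)) (rho e u))" if "y \<in> ?J" "u \<in> U" for y u
    using Leib_acts_zero[OF exp_e[OF that(1)] that(2)] that(2)
    by (simp add: rho_diff_left rho_sum_left rho_scale_left)
  define c where "c = (\<lambda>u. \<Sum>e\<in>E. rho e (rho (d e) u))"
  have lin: "Vector_Spaces.linear sV sV c"
    unfolding c_def Vector_Spaces.linear_iff
    by (auto simp: rho.add rho.scale sum.distrib V.scale_sum_right) unfold_locales
  have comm: "c (rho x u) = rho x (c u)" if u: "u \<in> U" for x u
  proof -
    \<comment> \<open>In place of antisymmetry: \<open>e \<star> x + x \<star> e\<close> acts as
      zero on \<open>W\<close>, hence pairs to zero with everything.\<close>
    have skew: "tform (x \<star> e) f = - tform e (x \<star> f)" for e f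
    proof -
      have "tform e (x \<star> f) = tform (e \<star> x) f" by (simp add: tform_invariant)
      moreover have "tform (e \<star> x + x \<star> e) f = 0"
        by (rule tform_zero) (simp add: W_facts rho_add_left rho_mult)
      ultimately show ?thesis by (simp add: tform_add_left eq_neg_iff_add_eq_0 add.commute)
    qed
    have "rho x (c u) - c (rho x u) = (\<Sum>e\<in>E. rho (x \<star> e) (rho (d e) u) + rho e (rho (x \<star> d e) u))"
      unfolding c_def using u
      by (simp add: rho.sum sum_subtractf[symmetric] rho_mult rho_closed rho.diff)
    also have "\<dots> = (\<Sum>e\<in>E. \<Sum>e'\<in>E. sV (tform (x \<star> e) (d e')) (rho e' (rho (d e) u)))
        + (\<Sum>e\<in>E. \<Sum>e'\<in>E. sV (tform e' (x \<star> d e)) (rho e (rho (d e') u)))"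
      unfolding sum.distrib
    proof (intro arg_cong2[of _ _ _ _ "(+)"] sum.cong refl)
      fix e assume e: "e \<in> E"
      show "rho (x \<star> e) (rho (d e) u) = (\<Sum>e'\<in>E. sV (tform (x \<star> e) (d e')) (rho e' (rho (d e) u)))"
        by (rule act_e) (use idealD(2)[OF complement_ideal EJ[OF e]] rho_closed[OF u] in auto)
      show "rho e (rho (x \<star> d e) u) = (\<Sum>e'\<in>E. sV (tform e' (x \<star> d e)) (rho e (rho (d e') u)))"
        using act_d[OF idealD(2)[OF complement_ideal dJ[OF e]] u] by (simp add: rho.sum rho.scale)
    qed
    also have "(\<Sum>e\<in>E. \<Sum>e'\<in>E. sV (tform e' (x \<star> d e)) (rho e (rho (d e') u)))
        = (\<Sum>e\<in>E. \<Sum>e'\<in>E. sV (tform e (x \<star> d e')) (rho e' (rho (d e) u)))"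
      by (rule sum.swap)
    also have "(\<Sum>e\<in>E. \<Sum>e'\<in>E. sV (tform (x \<star> e) (d e')) (rho e' (rho (d e) u))) + \<dots> = 0"
      by (simp add: skew sum.distrib[symmetric] V.scale_minus_left)
    finally show ?thesis by simp
  qed
  have into: "c u \<in> W'" if "submodule W'" "\<forall>x. rho x u \<in> W'" for W' u
    using that unfolding c_def submodule_def by (intro V.subspace_sum) auto
  have cW: "c w \<in> W" if "w \<in> W" for w using into[OF W] that W_facts(3) by blast
  \<comment> \<open>An empty \<open>E\<close> would leave no vector outside \<open>Leib\<close> that
    is Killing-orthogonal to the proper subspace \<open>act_kernel\<close>.\<close>
  have "E \<noteq> {}"
  proof
    assume "E = {}"
    hence "?J \<subseteq> Lb" using spB1 spB0 B1(1) by (auto simp: E_def)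
    moreover have "act_kernel \<noteq> UNIV" using nontriv by (auto simp: act_kernel_def)
    moreover have "Lb \<subseteq> act_kernel" using Leib_acts_zero W_facts(2) by (auto simp: act_kernel_def)
    ultimately show False
      using exists_killing_orthogonal[OF idealD(1)[OF act_kernel_ideal]] by (auto simp: complement_def)
  qed
  have trace: "mtrace (B.mat_on c) = of_nat (card E)"
  proof -
    have "mtrace (B.mat_on c) = (\<Sum>e\<in>E. mtrace (B.mat_on (\<lambda>v. rho e (rho (d e) v))))"
      unfolding c_def by (rule mtrace_mat_on_sum[OF fin]) (simp add: W_facts(3))
    also have "\<dots> = (\<Sum>e\<in>E. tform e (d e))"
      unfolding tform_def using B.mat_on_comp[OF rho_linear W_facts(3) W_facts(3)] by simp
    finally show ?thesis by (simp add: d)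
  qed
  have "\<exists>w\<in>W. (c ^^ m) w \<noteq> 0" for m
  proof (rule ccontr)
    assume "\<not> ?thesis"
    hence "B.mat_on (c ^^ m) = B.mat_on (\<lambda>v. 0)" by (intro B.mat_on_cong) auto
    hence "B.mat_on c ^\<^sub>m m = 0\<^sub>m (length bs) (length bs)" using B.mat_on_pow[OF lin cW, of m] B.mat_on_zero by simp
    hence "mtrace (B.mat_on c) = 0" by (rule nilpotent_mtrace_zero[OF B.mat_on_carrier])
    thus False using trace fin \<open>E \<noteq> {}\<close> by simp
  qed
  thus ?thesis using lin comm into by (intro exI[of _ c]) simp
qed

end

context semisimple_rep
begin

text \<open>Fitting decomposition of \<open>W\<close> under the Casimir operator \<open>c\<close>.
  On the stable image \<open>c\<close> is onto, so \<open>v\<close> can be corrected by an element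
  of \<open>W\<close> until a power of \<open>c\<close> kills it. What remains lies in the kernel
  part, which is smaller because \<open>c\<close> is not nilpotent; \<open>W\<close> may thus be any
  submodule, not only an irreducible one.\<close>

theorem whitehead:
  assumes "submodule W" "W \<subseteq> V.span F" "finite F" "v \<in> U" "\<And>x. rho x v \<in> W"
  shows "\<exists>w\<in>W. \<forall>x. rho x (v - w) = 0"
  using assms
proof (induction "V.dim W" arbitrary: W v rule: less_induct)
  case less
  note W = less.prems(1) and F = less.prems(2,3) and vU = less.prems(4) and vW = less.prems(5)
  note Wf = W_subspace[OF W] W_U[OF W] W_closed[OF W]
  obtain Bs where Bs: "Bs \<subseteq> W" "V.independent Bs" "W \<subseteq> V.span Bs" by (rule V.maximal_independent_subset)
  have "finite Bs" using V.finite_independent_subset_span[OF F(2) Bs(2)] Bs(1) F(1) by blast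
  then obtain bs where bs: "set bs = Bs" "distinct bs" using finite_distinct_list by blast
  interpret semisimple_based_rep sL BL mult lbs sV rho U bs W
    by unfold_locales (use bs Bs W Wf(1) in \<open>auto simp: V.span_subspace\<close>)
  show ?case
  proof (cases "\<exists>x. \<exists>w\<in>W. rho x w \<noteq> 0")
    case False
    hence "rho x v = 0" for x using vW by (intro double_action_zero_imp[OF vU]) blast
    thus ?thesis using Wf(1) by (intro bexI[of _ 0]) (auto simp: V.subspace_0)
  next
    case True
    obtain c where lin: "Vector_Spaces.linear sV sV c"
      and comm': "\<forall>x. \<forall>u\<in>U. c (rho x u) = rho x (c u)"
      and into': "\<forall>W' u. submodule W' \<and> u \<in> U \<and> (\<forall>x. rho x u \<in> W') \<longrightarrow> c u \<in> W'"
      and nonnil': "\<forall>m. \<exists>w\<in>W. (c ^^ m) w \<noteq> 0"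
      using casimir_exists[OF True] by (elim exE conjE) (rule that)
    have comm: "c (rho x u) = rho x (c u)" if "u \<in> U" for x u using comm' that by simp
    have into: "c u \<in> W'" if "submodule W'" "u \<in> U" "\<forall>x. rho x u \<in> W'" for W' u using into' that by simp
    have nonnil: "\<exists>w\<in>W. (c ^^ m) w \<noteq> 0" for m using nonnil' by simp
    interpret c: Vector_Spaces.linear sV sV c by (rule lin)
    have cm: "(c ^^ m) (u + u') = (c ^^ m) u + (c ^^ m) u'" "(c ^^ m) (sV a u) = sV a ((c ^^ m) u)"
      "(c ^^ m) (u - u') = (c ^^ m) u - (c ^^ m) u'" "(c ^^ m) 0 = 0" for m u u' a
      by (induction m) (auto simp: c.add c.scale c.diff c.zero)
    have Usub: "submodule U" using U rho_closed by (simp add: submodule_def)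
    have cU: "c u \<in> U" if "u \<in> U" for u using into[OF Usub that] rho_closed[OF that] by blast
    have cmU: "(c ^^ m) u \<in> U" if "u \<in> U" for m u using that cU by (induction m) auto
    have cmcomm: "(c ^^ m) (rho x u) = rho x ((c ^^ m) u)" if "u \<in> U" for m x u
      using that by (induction m) (auto simp: comm cmU)
    have cW: "c w \<in> W" if "w \<in> W" for w using into[OF W Wf(2)[OF that]] Wf(3)[OF that] by blast
    have sub: "V.subspace ((c ^^ m) ` W)" for m
      using Wf(1) by (auto intro!: V.subspaceI simp: image_iff cm(1,2)[symmetric])
        (metis V.subspace_0 cm(4), metis V.subspace_add cm(1), metis V.subspace_scale cm(2))
    have anti: "(c ^^ Suc m) ` W \<subseteq> (c ^^ m) ` W" for m using cW by (auto simp: funpow_swap1)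
    have inW: "(c ^^ m) w \<in> W" if "w \<in> W" for m w using that cW by (induction m) auto
    obtain m where m: "\<And>k. V.dim ((c ^^ m) ` W) \<le> V.dim ((c ^^ k) ` W)"
      using ex_has_least_nat[of "\<lambda>_. True" 0 "\<lambda>m. V.dim ((c ^^ m) ` W)"] by blast
    have stable: "(c ^^ Suc m) ` W = (c ^^ m) ` W"
    proof (rule ccontr)
      assume "(c ^^ Suc m) ` W \<noteq> (c ^^ m) ` W"
      hence "(c ^^ Suc m) ` W \<subset> (c ^^ m) ` W" using anti by blast
      moreover have "(c ^^ m) ` W \<subseteq> V.span F" using F(1) inW by blast
      ultimately have "V.dim ((c ^^ Suc m) ` W) < V.dim ((c ^^ m) ` W)"
        using V.dim_psubset_subspace[OF sub sub _ _ F(2)] by blast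
      with m[of "Suc m"] show False by simp
    qed
    \<comment> \<open>One application of \<open>c\<close> moves \<open>v\<close> into
      \<open>W\<close> and the other \<open>m\<close> reach the stable image, hence the exponent
      \<open>Suc m\<close> below.\<close>
    have "c v \<in> W" using into[OF W vU] vW by blast
    hence "(c ^^ Suc m) v \<in> (c ^^ Suc m) ` W" unfolding stable by (auto simp: funpow_swap1)
    then obtain w where w: "w \<in> W" "(c ^^ Suc m) v = (c ^^ Suc m) w" by blast
    define W' where "W' = {w \<in> W. (c ^^ Suc m) w = 0}"
    have "submodule W'" unfolding submodule_def W'_def
    proof (intro conjI allI ballI)
      show "V.subspace {w \<in> W. (c ^^ Suc m) w = 0}"
        using Wf(1) by (intro V.subspaceI) (auto simp del: funpow.simps simp: cm V.subspace_0 V.subspace_add V.subspace_scale)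
      show "rho x u \<in> {w \<in> W. (c ^^ Suc m) w = 0}" if "u \<in> {w \<in> W. (c ^^ Suc m) w = 0}" for x u
        using that Wf(2,3) cmcomm[of u "Suc m" x] by (auto simp del: funpow.simps simp: rho.zero)
    qed (use Wf(2) in auto)
    moreover have "W' \<subset> W" using nonnil[of "Suc m"] by (auto simp: W'_def)
    moreover have "V.dim W' < V.dim W"
      using V.dim_psubset_subspace[OF _ Wf(1) \<open>W' \<subset> W\<close> F] \<open>submodule W'\<close> by (simp add: submodule_def)
    moreover have "rho x (v - w) \<in> W'" for x
    proof -
      have "rho x (v - w) \<in> W" using vW Wf(3)[OF w(1)] Wf(1) by (simp add: rho.diff V.subspace_diff)
      moreover have "v - w \<in> U" using vU Wf(2)[OF w(1)] U by (simp add: V.subspace_diff)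
      hence "(c ^^ Suc m) (rho x (v - w)) = rho x ((c ^^ Suc m) v - (c ^^ Suc m) w)"
        using cmcomm[of "v - w" "Suc m" x] cm(3)[of "Suc m" v w] by simp
      hence "(c ^^ Suc m) (rho x (v - w)) = 0" using w(2) by (simp only: diff_self rho.zero)
      ultimately show ?thesis by (simp add: W'_def)
    qed
    moreover have "v - w \<in> U" using vU Wf(2)[OF w(1)] U by (simp add: V.subspace_diff)
    ultimately obtain w' where w': "w' \<in> W'" "\<forall>x. rho x (v - w - w') = 0"
      using less.hyps[of W' "v - w"] F by blast
    have "w + w' \<in> W" using w(1) w'(1) Wf(1) by (auto simp: W'_def V.subspace_add)
    thus ?thesis using w'(2) by (intro bexI[of _ "w + w'"]) (auto simp: algebra_simps)
  qed
qed

end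

section \<open>Leibniz cochains\<close>

text \<open>Only the left action is kept, the right one being its negative;
  \<open>invariants_zero\<close> is the hypothesis on right invariants in this form.\<close>

locale leibniz_cochains = semisimple_leibniz sL BL mult lbs + M: finite_dimensional_vector_space sM BM
  for sL :: "'f::field_char_0 \<Rightarrow> 'l::ab_group_add \<Rightarrow> 'l" and BL and mult :: "'l \<Rightarrow> 'l \<Rightarrow> 'l" (infixl \<open>\<star>\<close> 70)
    and lbs and sM :: "'f \<Rightarrow> 'm::ab_group_add \<Rightarrow> 'm" and BM +
  fixes lact :: "'l \<Rightarrow> 'm \<Rightarrow> 'm"
  assumes lact_bilin: "bilinear_map sL sM sM lact"
    and lact_mult: "lact (x \<star> y) m = lact x (lact y m) - lact y (lact x m)"
    and invariants_zero: "(\<And>x. lact x m = 0) \<Longrightarrow> m = 0"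
begin

sublocale ar: Vector_Spaces.linear sM sM "lact x" for x using lact_bilin by (simp add: bilinear_map_def)
sublocale al: Vector_Spaces.linear sL sM "\<lambda>x. lact x m" for m using lact_bilin by (simp add: bilinear_map_def)

definition fscale :: "'f \<Rightarrow> ('l list \<Rightarrow> 'm) \<Rightarrow> 'l list \<Rightarrow> 'm" where
  "fscale c f = (\<lambda>xs. sM c (f xs))"

lemma fscale_apply[simp]: "fscale c f xs = sM c (f xs)"
  by (simp add: fscale_def)

sublocale F: vector_space fscale
  by unfold_locales (auto simp: fun_eq_iff M.scale_right_distrib M.scale_left_distrib)

lemma minus_fun_apply: "(f - g) xs = f xs - (g xs :: 'm)" for f g :: "'l list \<Rightarrow> 'm"
  by (simp add: fun_diff_def)

lemma sum_fun_apply: "(\<Sum>i\<in>I. f i) xs = (\<Sum>i\<in>I. f i xs)" for f :: "'i \<Rightarrow> 'l list \<Rightarrow> 'm"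
  by (induction I rule: infinite_finite_induct) auto

text \<open>Linearity in every slot is stated at a single argument list, so that it can be proved by
  induction on the list, with \<open>lin_at_Cons\<close> passing to an insertion of the
  head.\<close>

definition lin_at :: "('l list \<Rightarrow> 'm) \<Rightarrow> 'l list \<Rightarrow> bool" where
  "lin_at f xs \<longleftrightarrow> (\<forall>i<length xs. \<forall>y z c. f (xs[i := y + z]) = f (xs[i := y]) + f (xs[i := z]) \<and>
     f (xs[i := sL c y]) = sM c (f (xs[i := y])))"

definition mlin :: "('l list \<Rightarrow> 'm) \<Rightarrow> bool" where "mlin f \<longleftrightarrow> (\<forall>xs. lin_at f xs)"

definition ins :: "'l \<Rightarrow> ('l list \<Rightarrow> 'm) \<Rightarrow> 'l list \<Rightarrow> 'm" where "ins x f = (\<lambda>xs. f (x # xs))"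

lemma ins_apply[simp]: "ins x f xs = f (x # xs)"
  by (simp add: ins_def)

lemma lin_at_Nil[simp]: "lin_at f []" by (simp add: lin_at_def)

lemma lin_at_Cons:
  "lin_at f (x # xs) \<longleftrightarrow> (\<forall>y z c. f ((y + z) # xs) = f (y # xs) + f (z # xs) \<and> f (sL c y # xs) = sM c (f (y # xs)))
     \<and> lin_at (ins x f) xs"
  unfolding lin_at_def ins_def by (auto simp: All_less_Suc2)

lemma mlin_Cons:
  assumes "mlin f"
  shows "f ((y + z) # xs) = f (y # xs) + f (z # xs)" "f (sL c y # xs) = sM c (f (y # xs))" "mlin (ins y f)"
  using assms lin_at_Cons[of f] by (auto simp: mlin_def)

lemma lin_at_add: "lin_at f xs \<Longrightarrow> lin_at g xs \<Longrightarrow> lin_at (f + g) xs"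
  by (simp add: lin_at_def M.scale_right_distrib algebra_simps)

lemma lin_at_diff: "lin_at f xs \<Longrightarrow> lin_at g xs \<Longrightarrow> lin_at (f - g) xs"
  by (simp add: lin_at_def minus_fun_apply M.scale_right_diff_distrib algebra_simps)

lemma lin_at_scale: "lin_at f xs \<Longrightarrow> lin_at (fscale c f) xs"
  by (simp add: lin_at_def M.scale_right_distrib M.scale_left_commute)

lemma mlin_subspace: "F.subspace {f. mlin f}"
  by (intro F.subspaceI) (auto simp: mlin_def lin_at_add lin_at_scale, simp add: lin_at_def)

lemma ins_linear: "Vector_Spaces.linear fscale fscale (ins x)"
  by unfold_locales (auto simp: fun_eq_iff)

sublocale ins: Vector_Spaces.linear fscale fscale "ins x" for x by (rule ins_linear)

lemma ins_add_left: "mlin f \<Longrightarrow> ins (x + y) f = ins x f + ins y f"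
  and ins_scale_left: "mlin f \<Longrightarrow> ins (sL c x) f = fscale c (ins x f)"
  by (auto simp: fun_eq_iff mlin_Cons)

lemma ins_diff_left: "mlin f \<Longrightarrow> ins (x - y) f = ins x f - ins y f"
  using ins_add_left[of f "x - y" y] by simp

text \<open>The natural action on multilinear maps, with closed form \<open>theta_eq_sum\<close>.
  Recursion along the list makes the commutation rule \<open>ins_theta\<close> immediate.\<close>

primrec theta_at :: "'l \<Rightarrow> 'l list \<Rightarrow> ('l list \<Rightarrow> 'm) \<Rightarrow> 'm" where
  "theta_at x [] f = lact x (f [])"
| "theta_at x (z # zs) f = theta_at x zs (ins z f) - f ((x \<star> z) # zs)"

definition theta :: "'l \<Rightarrow> ('l list \<Rightarrow> 'm) \<Rightarrow> 'l list \<Rightarrow> 'm" where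
  "theta x f = (\<lambda>zs. theta_at x zs f)"

lemma theta_Nil[simp]: "theta x f [] = lact x (f [])"
  by (simp add: theta_def)

lemma theta_Cons: "theta x f (z # zs) = theta x (ins z f) zs - f ((x \<star> z) # zs)"
  by (simp add: theta_def)

lemma ins_theta: "ins z (theta x f) = theta x (ins z f) - ins (x \<star> z) f"
  by (simp add: fun_eq_iff theta_Cons minus_fun_apply)

lemma theta_linear: "Vector_Spaces.linear fscale fscale (theta x)"
proof -
  have "theta x (f + g) zs = theta x f zs + theta x g zs" for f g zs
    by (induction zs arbitrary: f g) (auto simp: theta_Cons ar.add ins.add)
  moreover have "theta x (fscale c f) zs = sM c (theta x f zs)" for c f zs
    by (induction zs arbitrary: f) (auto simp: theta_Cons ar.scale ins.scale M.scale_right_diff_distrib)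
  ultimately show ?thesis by unfold_locales (auto simp: fun_eq_iff)
qed

sublocale th: Vector_Spaces.linear fscale fscale "theta x" for x by (rule theta_linear)

lemma theta_add_left: "mlin f \<Longrightarrow> theta (x + y) f = theta x f + theta y f"
proof
  fix zs
  show "mlin f \<Longrightarrow> theta (x + y) f zs = (theta x f + theta y f) zs"
    by (induction zs arbitrary: f) (auto simp: theta_Cons al.add ml.add mlin_Cons)
qed

lemma theta_scale_left: "mlin f \<Longrightarrow> theta (sL c x) f = fscale c (theta x f)"
proof
  fix zs
  show "mlin f \<Longrightarrow> theta (sL c x) f zs = fscale c (theta x f) zs"
    by (induction zs arbitrary: f) (auto simp: theta_Cons al.scale ml.scale mlin_Cons M.scale_right_diff_distrib)
qed

lemma mlin_theta: "mlin f \<Longrightarrow> mlin (theta x f)"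
  unfolding mlin_def[of "theta x f"]
proof
  fix zs
  show "mlin f \<Longrightarrow> lin_at (theta x f) zs"
  proof (induction zs arbitrary: f)
    case (Cons z zs)
    have "lin_at (theta x (ins z f) - ins (x \<star> z) f) zs"
      using Cons mlin_Cons(3)[OF Cons.prems] by (intro lin_at_diff) (auto simp: mlin_def)
    thus ?case using Cons.prems
      by (simp add: lin_at_Cons ins_theta theta_Cons ins_add_left ins_scale_left th.add th.scale mr.add mr.scale mlin_Cons
          M.scale_right_diff_distrib)
  qed simp
qed

text \<open>The base case is the module law of \<open>lact\<close>. For the head entry the Leibniz
  identity gives the commutator, and the terms in which \<open>x\<close> and \<open>y\<close> hit
  different entries cancel.\<close>

lemma theta_mult: "mlin f \<Longrightarrow> theta (x \<star> y) f = theta x (theta y f) - theta y (theta x f)"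
proof
  fix zs
  show "mlin f \<Longrightarrow> theta (x \<star> y) f zs = (theta x (theta y f) - theta y (theta x f)) zs"
  proof (induction zs arbitrary: f)
    case Nil
    then show ?case by (simp add: lact_mult minus_fun_apply)
  next
    case (Cons z zs)
    have "f (((x \<star> y) \<star> z) # zs) = f ((x \<star> (y \<star> z)) # zs) - f ((y \<star> (x \<star> z)) # zs)"
      using fun_cong[OF ins_diff_left[OF Cons.prems, of "x \<star> (y \<star> z)" "y \<star> (x \<star> z)"], of zs]
      by (simp add: leib' minus_fun_apply)
    moreover have "theta (x \<star> y) (ins z f) zs = theta x (theta y (ins z f)) zs - theta y (theta x (ins z f)) zs"
      using Cons.IH[OF mlin_Cons(3)[OF Cons.prems]] unfolding minus_fun_apply .
    ultimately show ?case
      by (simp add: theta_Cons ins_theta th.diff minus_fun_apply algebra_simps)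
  qed
qed

lemma theta_rep: "semisimple_rep sL BL mult lbs fscale theta {f. mlin f}"
  by unfold_locales
    (auto simp: theta_mult theta_add_left theta_scale_left mlin_theta mlin_subspace theta_linear)

sublocale T: semisimple_rep sL BL mult lbs fscale theta "{f. mlin f}" by (rule theta_rep)

text \<open>The recursion is Cartan's formula \<open>ins x (D f) = theta x f - D (ins x f)\<close>.\<close>

primrec D_at :: "'l list \<Rightarrow> ('l list \<Rightarrow> 'm) \<Rightarrow> 'm" where
  "D_at [] f = 0"
| "D_at (x # xs) f = theta x f xs - D_at xs (ins x f)"

definition D :: "('l list \<Rightarrow> 'm) \<Rightarrow> 'l list \<Rightarrow> 'm" where "D f = (\<lambda>xs. D_at xs f)"

lemma D_Nil[simp]: "D f [] = 0"
  by (simp add: D_def)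

lemma D_Cons: "D f (x # xs) = theta x f xs - D (ins x f) xs"
  by (simp add: D_def)

lemma ins_D: "ins x (D f) = theta x f - D (ins x f)"
  by (simp add: fun_eq_iff D_Cons minus_fun_apply)

lemma D_linear: "Vector_Spaces.linear fscale fscale D"
proof -
  have "D (f + g) zs = D f zs + D g zs" for f g zs
    by (induction zs arbitrary: f g) (auto simp: D_Cons th.add ins.add)
  moreover have "D (fscale c f) zs = sM c (D f zs)" for c f zs
    by (induction zs arbitrary: f) (auto simp: D_Cons th.scale ins.scale M.scale_right_diff_distrib)
  ultimately show ?thesis by unfold_locales (auto simp: fun_eq_iff)
qed

sublocale D: Vector_Spaces.linear fscale fscale D by (rule D_linear)

lemma mlin_D: "mlin f \<Longrightarrow> mlin (D f)"
  unfolding mlin_def[of "D f"]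
proof
  fix zs
  show "mlin f \<Longrightarrow> lin_at (D f) zs"
  proof (induction zs arbitrary: f)
    case (Cons z zs)
    have "lin_at (theta z f - D (ins z f)) zs"
      using Cons mlin_Cons(3)[OF Cons.prems] mlin_theta[OF Cons.prems] by (intro lin_at_diff) (auto simp: mlin_def)
    thus ?case using Cons.prems
      by (simp add: lin_at_Cons ins_D D_Cons ins_add_left ins_scale_left theta_add_left theta_scale_left D.add D.scale
          M.scale_right_diff_distrib)
  qed simp
qed

text \<open>After an insertion of \<open>z\<close> on both sides, the terms containing
  \<open>D\<close> agree by induction and the remaining ones by \<open>theta_mult\<close>.\<close>

lemma theta_D: "mlin f \<Longrightarrow> theta x (D f) = D (theta x f)"
proof
  fix zs
  show "mlin f \<Longrightarrow> theta x (D f) zs = D (theta x f) zs"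
  proof (induction zs arbitrary: f)
    case (Cons z zs)
    have "theta x (D (ins z f)) zs = D (theta x (ins z f)) zs"
      using Cons.IH[OF mlin_Cons(3)[OF Cons.prems]] .
    thus ?case using fun_cong[OF theta_mult[OF Cons.prems, of x z], of zs]
      by (simp add: theta_Cons D_Cons ins_D ins_theta th.diff D.diff minus_fun_apply algebra_simps)
  qed (simp add: ar.zero)
qed

text \<open>By Cartan's formula an insertion into \<open>D (D f)\<close> is the commutator of
  \<open>theta\<close> and \<open>D\<close>, which vanishes, plus the same expression for an
  inserted cochain.\<close>

lemma D_D: "mlin f \<Longrightarrow> D (D f) = 0"
proof
  fix zs
  show "mlin f \<Longrightarrow> D (D f) zs = 0 zs"
  proof (induction zs arbitrary: f)
    case (Cons z zs)
    have "D (D (ins z f)) zs = 0" using Cons.IH[OF mlin_Cons(3)[OF Cons.prems]] unfolding zero_fun_apply .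
    thus ?case using theta_D[OF Cons.prems, of z]
      by (simp add: D_Cons ins_D D.diff minus_fun_apply)
  qed simp
qed

text \<open>Unlike in \<open>cochain\<close>, the values on other lengths are fixed to be zero.
  Cochains are then equal exactly when they agree as functions, and each degree is
  finite-dimensional.\<close>

definition C :: "nat \<Rightarrow> ('l list \<Rightarrow> 'm) set" where
  "C n = {f. mlin f \<and> (\<forall>xs. length xs \<noteq> n \<longrightarrow> f xs = 0)}"

lemma C_mlin: "f \<in> C n \<Longrightarrow> mlin f"
  by (simp add: C_def)

lemma C_subspace: "F.subspace (C n)"
  using mlin_subspace unfolding F.subspace_def C_def by simp

lemma ins_C: "f \<in> C (Suc n) \<Longrightarrow> ins x f \<in> C n"
  by (simp add: C_def mlin_Cons)

lemma theta_C: "f \<in> C n \<Longrightarrow> theta x f \<in> C n"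
proof -
  have "(\<forall>xs. length xs \<noteq> n \<longrightarrow> f xs = 0) \<Longrightarrow> length zs \<noteq> n \<Longrightarrow> theta x f zs = 0" for f n zs
  proof (induction zs arbitrary: f n)
    case (Cons z zs)
    show ?case
    proof (cases n)
      case 0
      hence "ins z f = 0" using Cons.prems by (auto simp: fun_eq_iff)
      thus ?thesis using Cons.prems by (simp add: theta_Cons th.zero)
    next
      case (Suc m)
      have "theta x (ins z f) zs = 0" by (rule Cons.IH[of m]) (use Cons.prems Suc in auto)
      thus ?thesis using Cons.prems by (simp add: theta_Cons)
    qed
  qed (simp add: ar.zero)
  thus "f \<in> C n \<Longrightarrow> theta x f \<in> C n" unfolding C_def using mlin_theta by blast
qed

lemma D_C: "f \<in> C n \<Longrightarrow> D f \<in> C (Suc n)"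
proof -
  have "f \<in> C n \<Longrightarrow> length zs \<noteq> Suc n \<Longrightarrow> D f zs = 0" for f n zs
  proof (induction zs arbitrary: f n)
    case (Cons z zs)
    have "theta z f zs = 0" using theta_C[OF Cons.prems(1), of z] Cons.prems(2) by (simp add: C_def)
    moreover have "D (ins z f) zs = 0"
    proof (cases n)
      case 0
      hence "ins z f = 0" using Cons.prems by (auto simp: fun_eq_iff C_def)
      thus ?thesis by (simp add: D.zero)
    next
      case (Suc m)
      show ?thesis
      proof (rule Cons.IH[of _ m])
        show "ins z f \<in> C m" using ins_C Cons.prems(1) unfolding Suc .
        show "length zs \<noteq> Suc m" using Cons.prems(2) Suc by simp
      qed
    qed
    ultimately show ?case by (simp add: D_Cons)
  qed simp
  thus "f \<in> C n \<Longrightarrow> D f \<in> C (Suc n)" unfolding C_def using mlin_D by blast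
qed

text \<open>The tensor product of the coordinate functional of \<open>b\<close> with
  \<open>g\<close>, a cochain of one degree more.\<close>

definition ext :: "'l \<Rightarrow> ('l list \<Rightarrow> 'm) \<Rightarrow> 'l list \<Rightarrow> 'm" where
  "ext b g = (\<lambda>xs. case xs of [] \<Rightarrow> 0 | x # ys \<Rightarrow> sM (L.representation BL x b) (g ys))"

lemma ext_simps[simp]: "ext b g [] = 0" "ext b g (x # ys) = sM (L.representation BL x b) (g ys)"
  by (simp_all add: ext_def)

lemma ins_ext: "ins x (ext b g) = fscale (L.representation BL x b) g"
  by (simp add: fun_eq_iff)

lemma rep_BL: "L.representation BL (x + y) b = L.representation BL x b + L.representation BL y b"
  "L.representation BL (sL c x) b = c * L.representation BL x b"
  by (simp_all add: L.representation_add[OF L.independent_Basis] L.representation_scale[OF L.independent_Basis] L.span_Basis)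

lemma ext_C: "g \<in> C n \<Longrightarrow> ext b g \<in> C (Suc n)"
proof -
  assume g: "g \<in> C n"
  have "lin_at (ext b g) xs" for xs
    by (cases xs) (use C_mlin[OF g] in \<open>auto simp: lin_at_Cons rep_BL M.scale_left_distrib ins_ext mlin_def lin_at_scale\<close>)
  moreover have "ext b g xs = 0" if "length xs \<noteq> Suc n" for xs
    using that g by (cases xs) (auto simp: C_def)
  ultimately show ?thesis unfolding C_def mlin_def by blast
qed

lemma ext_linear: "Vector_Spaces.linear fscale fscale (ext b)"
proof -
  have "ext b (f + g) xs = (ext b f + ext b g) xs" "ext b (fscale c f) xs = fscale c (ext b f) xs" for f g c xs
    by (cases xs; simp add: M.scale_right_distrib M.scale_left_commute)+
  thus ?thesis by unfold_locales (auto simp: fun_eq_iff)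
qed

lemma sum_rep_BL: "(\<Sum>b\<in>BL. sL (L.representation BL x b) b) = x"
  using L.sum_representation_eq[OF L.independent_Basis, of x BL] L.span_Basis L.finite_Basis by simp

lemma cochain_expand: "f \<in> C (Suc n) \<Longrightarrow> f = (\<Sum>b\<in>BL. ext b (ins b f))"
proof
  fix xs assume f: "f \<in> C (Suc n)"
  show "f xs = (\<Sum>b\<in>BL. ext b (ins b f)) xs"
  proof (cases xs)
    case Nil
    thus ?thesis using f by (simp add: sum_fun_apply C_def)
  next
    case (Cons x ys)
    have lin: "Vector_Spaces.linear sL sM (\<lambda>x. f (x # ys))"
      by unfold_locales (auto simp: mlin_Cons[OF C_mlin[OF f]])
    then interpret l: Vector_Spaces.linear sL sM "\<lambda>x. f (x # ys)" .
    have "f (x # ys) = f ((\<Sum>b\<in>BL. sL (L.representation BL x b) b) # ys)" by (simp add: sum_rep_BL)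
    also have "\<dots> = (\<Sum>b\<in>BL. sM (L.representation BL x b) (f (b # ys)))" by (simp add: l.sum l.scale)
    finally show ?thesis using Cons by (simp add: sum_fun_apply)
  qed
qed

lemma C_finite_dim: "\<exists>F. finite F \<and> C n \<subseteq> F.span F"
proof (induction n)
  case 0
  let ?e = "\<lambda>b xs. if xs = [] then b else 0"
  have "f \<in> F.span (?e ` BM)" if f: "f \<in> C 0" for f
  proof -
    have "f = (\<Sum>b\<in>BM. fscale (M.representation BM (f []) b) (?e b))"
    proof
      fix xs
      have "(\<Sum>b\<in>BM. sM (M.representation BM (f []) b) b) = f []"
        using M.sum_representation_eq[OF M.independent_Basis, of "f []" BM] M.span_Basis M.finite_Basis by simp
      thus "f xs = (\<Sum>b\<in>BM. fscale (M.representation BM (f []) b) (?e b)) xs"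
        using f by (cases "xs = []") (simp_all add: sum_fun_apply C_def)
    qed
    also have "\<dots> \<in> F.span (?e ` BM)" by (intro F.span_sum F.span_scale F.span_base) auto
    finally show ?thesis .
  qed
  thus ?case using M.finite_Basis by (intro exI[of _ "?e ` BM"]) blast
next
  case (Suc n)
  then obtain F where F: "finite F" "C n \<subseteq> F.span F" by blast
  let ?F = "\<Union>b\<in>BL. ext b ` F"
  have "f \<in> F.span ?F" if f: "f \<in> C (Suc n)" for f
  proof -
    have "ext b (ins b f) \<in> F.span ?F" if b: "b \<in> BL" for b
    proof -
      interpret e: Vector_Spaces.linear fscale fscale "ext b" by (rule ext_linear)
      have "ext b (ins b f) \<in> ext b ` F.span F" using F(2) ins_C[OF f] by blast
      also have "\<dots> = F.span (ext b ` F)" by (rule e.span_image[symmetric])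
      also have "\<dots> \<subseteq> F.span ?F" using b by (intro F.span_mono) auto
      finally show ?thesis .
    qed
    hence "(\<Sum>b\<in>BL. ext b (ins b f)) \<in> F.span ?F" by (intro F.span_sum)
    thus ?thesis using cochain_expand[OF f] by simp
  qed
  thus ?case using F(1) L.finite_Basis by (intro exI[of _ ?F]) blast
qed

section \<open>Vanishing of cohomology for modules without invariants\<close>

lemma invariant_modulo:
  assumes "T.submodule W" "W \<subseteq> C n" "f \<in> C n" "\<And>x. theta x f \<in> W"
  shows "\<exists>w\<in>W. \<forall>x. theta x (f - w) = 0"
proof -
  obtain F where "finite F" "C n \<subseteq> F.span F" using C_finite_dim by blast
  thus ?thesis using T.whitehead[OF assms(1), of F f] assms C_mlin by blast
qed

theorem cocycle_is_coboundary:
  assumes "f \<in> C n" "D f = 0"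
  shows "case n of 0 \<Rightarrow> f = 0 | Suc k \<Rightarrow> \<exists>g\<in>C k. f = D g"
  using assms
proof (induction n arbitrary: f)
  case 0
  have "lact x (f []) = 0" for x using fun_cong[OF 0(2), of "[x]"] 0(1) by (simp add: D_Cons)
  hence "f [] = 0" by (rule invariants_zero)
  hence "f xs = 0" for xs using 0(1) by (cases "xs = []") (simp_all add: C_def)
  thus ?case by (simp add: fun_eq_iff)
next
  case (Suc k)
  have Dtheta: "theta x (D g) = D (theta x g)" if "g \<in> C j" for g j x using theta_D C_mlin[OF that] by blast
  \<comment> \<open>Whitehead's lemma is applied to the module of coboundaries; as
    \<open>D f = 0\<close>, Cartan's formula reads \<open>theta x f = D (ins x f)\<close>.\<close>
  have "\<exists>w\<in>D ` C k. \<forall>x. theta x (f - w) = 0"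
  proof (rule invariant_modulo)
    show "T.submodule (D ` C k)" unfolding T.submodule_def
    proof (intro conjI allI ballI)
      show "F.subspace (D ` C k)" by (rule D.subspace_image[OF C_subspace])
      show "theta x w \<in> D ` C k" if "w \<in> D ` C k" for x w
        using that Dtheta theta_C by (auto simp: image_iff)
    qed (use mlin_D C_mlin in auto)
    show "theta x f \<in> D ` C k" for x
    proof -
      have "theta x f - D (ins x f) = 0" unfolding ins_D[symmetric] Suc.prems(2) ins.zero ..
      hence "theta x f = D (ins x f)" by (simp only: right_minus_eq)
      thus ?thesis using ins_C[OF Suc.prems(1)] by simp
    qed
  qed (use D_C Suc.prems in auto)
  then obtain g0 where g0: "g0 \<in> C k" "\<And>x. theta x (f - D g0) = 0" by auto
  define h where "h = f - D g0"
  have h: "h \<in> C (Suc k)" using Suc.prems(1) D_C[OF g0(1)] C_subspace F.subspace_diff by (auto simp: h_def)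
  have Dh: "D h = 0" unfolding h_def D.diff Suc.prems(2) D_D[OF C_mlin[OF g0(1)]] by (rule diff_self)
  have thh: "theta x h = 0" for x using g0(2) by (simp add: h_def)
  have insC: "ins x h \<in> C k" for x by (rule ins_C[OF h])
  have Dins: "D (ins x h) = 0" for x 
  proof -
    have "theta x h - D (ins x h) = 0" unfolding ins_D[symmetric] Dh ins.zero ..
    thus ?thesis by (simp only: thh right_minus_eq)
  qed
  have h0: "h [] = 0" using h by (simp add: C_def)
  have "\<exists>g\<in>C k. h = D g"
  proof (cases k)
    case 0
    hence "ins x h = 0" for x using Suc.IH[OF insC Dins] by simp
    hence "h (x # xs) = 0" for x xs using ins_apply[of x h xs] by simp
    hence "h xs = 0" for xs using h0 by (cases xs) auto
    hence "h = D 0" by (auto simp: D.zero fun_eq_iff)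
    thus ?thesis using F.subspace_0[OF C_subspace] by blast
  next
    case (Suc j)
    hence "\<exists>g\<in>C j. ins b h = D g" for b using Suc.IH[OF insC Dins] by simp
    then obtain gb where gb: "\<And>b. gb b \<in> C j" "\<And>b. ins b h = D (gb b)" by metis
    \<comment> \<open>Preimages are chosen for basis elements only and combined through
      \<open>ext\<close>, which makes \<open>ins x g\<close> linear in \<open>x\<close>.\<close>
    define g where "g = (\<Sum>b\<in>BL. ext b (gb b))"
    have g: "g \<in> C k" unfolding g_def Suc by (intro F.subspace_sum[OF C_subspace] ext_C gb)
    have Dg: "D (ins x g) = ins x h" for x
    proof -
      have "D (ins x g) = (\<Sum>b\<in>BL. fscale (L.representation BL x b) (ins b h))"
        by (simp add: g_def ins.sum D.sum ins_ext D.scale gb(2))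
      also have "\<dots> = ins x (\<Sum>b\<in>BL. ext b (ins b h))" by (simp add: ins.sum ins_ext)
      finally show ?thesis using cochain_expand[OF h] by simp
    qed
    \<comment> \<open>The freedom in \<open>g\<close>: adding an element of \<open>W\<close> does
      not change \<open>D (ins x g)\<close>. Invariance of \<open>h\<close> puts every
      \<open>theta x g\<close> into \<open>W\<close>.\<close>
    define W where "W = {w \<in> C k. \<forall>x. D (ins x w) = 0}"
    have "\<exists>w\<in>W. \<forall>x. theta x (g - w) = 0"
    proof (rule invariant_modulo)
      have "F.subspace W" unfolding W_def
        using C_subspace[of k] by (intro F.subspaceI)
          (auto simp: F.subspace_0 F.subspace_add F.subspace_scale ins.zero ins.add ins.scale D.zero D.add D.scale)
      moreover have "theta x w \<in> W" if w: "w \<in> W" for x w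
      proof -
        have wC: "w \<in> C k" and D0: "\<And>y. D (ins y w) = 0" using w by (auto simp: W_def)
        have "D (ins y (theta x w)) = 0" for y
          using Dtheta[OF ins_C[OF wC[unfolded Suc]], of x y] D0 by (simp add: ins_theta D.diff th.zero)
        thus ?thesis using theta_C[OF wC] by (simp add: W_def)
      qed
      ultimately show "T.submodule W" unfolding T.submodule_def using C_mlin by (auto simp: W_def)
      show "theta x g \<in> W" for x
      proof -
        have "D (ins y (theta x g)) = ins y (theta x h)" for y
          using Dtheta[OF ins_C[OF g[unfolded Suc]], of x y] by (simp add: ins_theta D.diff Dg)
        thus ?thesis using theta_C[OF g] by (simp add: W_def thh ins.zero)
      qed
    qed (use g in \<open>auto simp: W_def\<close>)
    then obtain w where w: "w \<in> W" "\<And>x. theta x (g - w) = 0" by blast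
    have wC: "w \<in> C k" using w(1) by (simp add: W_def)
    \<comment> \<open>The sign comes from Cartan's formula: on an invariant \<open>u\<close>,
      \<open>ins x (D u)\<close> equals \<open>- D (ins x u)\<close>.\<close>
    have "ins x (D (w - g)) = ins x h" for x
    proof -
      have "theta x (w - g) = 0" using w(2)[of x] by (simp add: th.diff)
      moreover have "D (ins x w) = 0" using w(1) by (simp add: W_def)
      ultimately show ?thesis unfolding ins_D ins.diff D.diff th.diff Dg by simp
    qed
    hence "h (x # xs) = D (w - g) (x # xs)" for x xs using ins_apply by metis
    hence "h xs = D (w - g) xs" for xs using h0 by (cases xs) auto
    thus ?thesis using F.subspace_diff[OF C_subspace wC g] by blast
  qed
  then obtain g where g: "g \<in> C k" "h = D g" by blast
  have "f = D (g0 + g)" unfolding D.add g(2)[symmetric] h_def by simp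
  thus ?case using F.subspace_add[OF C_subspace g0(1) g(1)] by auto
qed

section \<open>Comparison of the recursive differential with the explicit coboundary\<close>

lemma theta_eq_sum: "theta x f zs = lact x (f zs) - (\<Sum>i<length zs. f (zs[i := x \<star> zs ! i]))"
  by (induction zs arbitrary: f) (auto simp: theta_Cons sum.lessThan_Suc_shift simp del: sum.lessThan_Suc)

text \<open>With \<open>ract\<close> the negative of \<open>lact\<close>, the right action at the
  last place is the left-action summand for \<open>i = n\<close>. Peeling off the first argument,
  the summands with \<open>i = 0\<close> form \<open>theta\<close> and the others the negated
  coboundary of the inserted cochain, as in the recursion of \<open>D\<close>.\<close>

lemma cobound_eq_D:
  assumes ract: "\<And>m x. ract m x = - lact x m" and len: "length xs = Suc n"
  shows "cobound mult lact ract n f xs = D f xs"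
  using len
proof (induction n arbitrary: f xs)
  case 0
  then obtain x where "xs = [x]" by (auto simp: length_Suc_conv)
  thus ?case by (simp add: cobound_def sgnp_def ract D_Cons)
next
  case (Suc n)
  then obtain x ys where xs: "xs = x # ys" and ys: "length ys = Suc n" by (auto simp: length_Suc_conv)
  have del: "del 0 (x # zs) = zs" "del (Suc i) (x # zs) = x # del i zs" for i zs x by (simp_all add: del_def)
  have sg: "sgnp (Suc i) m = - sgnp i m" for i and m :: 'm by (simp add: sgnp_def)
  have s0: "sgnp 0 m = m" for m :: 'm by (simp add: sgnp_def)
  have 1: "(\<Sum>i<Suc n. sgnp i (lact (xs ! i) (f (del i xs))))
      = lact x (f ys) - (\<Sum>i<n. sgnp i (lact (ys ! i) (ins x f (del i ys))))"
    unfolding xs sum.lessThan_Suc_shift by (simp add: del sg s0 sum_negf)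
  have 2: "sgnp (Suc (Suc n)) (ract (f (take (Suc n) xs)) (xs ! Suc n))
      = - sgnp (Suc n) (ract (ins x f (take n ys)) (ys ! n))"
    by (simp add: xs sg)
  \<comment> \<open>The inner sum for \<open>j = 0\<close> is empty. Once \<open>j\<close> is
    shifted, the summands with \<open>i = 0\<close> give the bracket part of \<open>theta\<close>,
    and shifting \<open>i\<close> costs a sign.\<close>
  have 3: "(\<Sum>j\<in>{..Suc n}. \<Sum>i<j. sgnp (Suc i) (f (del i (xs[j := xs ! i \<star> xs ! j]))))
      = - (\<Sum>j\<le>n. f (ys[j := x \<star> ys ! j]))
        - (\<Sum>j\<in>{..n}. \<Sum>i<j. sgnp (Suc i) (ins x f (del i (ys[j := ys ! i \<star> ys ! j]))))"
    unfolding xs sum.atMost_Suc_shift sum.lessThan_Suc_shift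
    by (simp add: del sg s0 sum.distrib sum_negf sum_subtractf del: sum.lessThan_Suc sum.atMost_Suc)
  have 4: "theta x f ys = lact x (f ys) - (\<Sum>j\<le>n. f (ys[j := x \<star> ys ! j]))"
    unfolding theta_eq_sum ys lessThan_Suc_atMost ..
  have "cobound mult lact ract (Suc n) f xs = theta x f ys - cobound mult lact ract n (ins x f) ys"
    unfolding cobound_def 1 2 3 4 by (simp add: algebra_simps)
  also have "\<dots> = D f xs" unfolding xs D_Cons Suc.IH[OF ys] ..
  finally show ?case .
qed

lemma cochain_C: "f \<in> C n \<Longrightarrow> cochain sL sM n f"
  unfolding cochain_def Vector_Spaces.linear_iff
  using L.vector_space_axioms M.vector_space_axioms by (auto simp: C_def mlin_def lin_at_def)

lemma cochain_truncate: "cochain sL sM n f \<Longrightarrow> (\<lambda>xs. if length xs = n then f xs else 0) \<in> C n"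
  unfolding cochain_def Vector_Spaces.linear_iff C_def mlin_def lin_at_def by auto

lemma cobound_cong:
  assumes "\<And>ys. length ys = n \<Longrightarrow> f ys = g ys" "length xs = Suc n"
  shows "cobound mult lact ract n f xs = cobound mult lact ract n g xs"
  unfolding cobound_def using assms
  by (intro arg_cong2[of _ _ _ _ "(+)"] sum.cong refl) (auto simp: del_def)

theorem HL_vanishes_symmetric:
  assumes ract: "\<And>m x. ract m x = - lact x m"
  shows "HL_vanishes sL mult sM lact ract n"
  unfolding HL_vanishes_def
proof (intro allI impI, elim conjE)
  fix f assume f: "cochain sL sM n f" and cocycle: "\<forall>xs. length xs = Suc n \<longrightarrow> cobound mult lact ract n f xs = 0"
  \<comment> \<open>The coboundary on lists of length \<open>Suc n\<close> reads \<open>f\<close>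
    only on length \<open>n\<close>, so truncating \<open>f\<close> preserves the cocycle
    condition.\<close>
  let ?f = "\<lambda>xs. if length xs = n then f xs else 0"
  have fC: "?f \<in> C n" by (rule cochain_truncate[OF f])
  have "D ?f xs = 0" for xs
  proof (cases "length xs = Suc n")
    case True
    have "D ?f xs = cobound mult lact ract n f xs"
      unfolding cobound_eq_D[OF ract True, symmetric] by (rule cobound_cong[OF _ True]) simp
    thus ?thesis using cocycle True by simp
  next
    case False
    thus ?thesis using D_C[OF fC] by (simp add: C_def)
  qed
  hence "D ?f = 0" by (simp add: fun_eq_iff)
  note main = cocycle_is_coboundary[OF fC this]
  show "case n of 0 \<Rightarrow> f [] = 0
    | Suc k \<Rightarrow> \<exists>g. cochain sL sM k g \<and> (\<forall>xs. length xs = n \<longrightarrow> f xs = cobound mult lact ract k g xs)"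
  proof (cases n)
    case 0
    thus ?thesis using main fun_cong[of ?f 0 "[]"] by simp
  next
    case (Suc k)
    with main obtain g where g: "g \<in> C k" "?f = D g" by auto
    have "f xs = cobound mult lact ract k g xs" if "length xs = n" for xs
      using fun_cong[OF g(2), of xs] cobound_eq_D[OF ract, of xs k g] that Suc by simp
    thus ?thesis using cochain_C[OF g(1)] Suc by auto
  qed
qed

end

theorem theorem4p2:
  fixes sL :: "'f::field_char_0 \<Rightarrow> 'l::ab_group_add \<Rightarrow> 'l"
    and mult :: "'l \<Rightarrow> 'l \<Rightarrow> 'l"
    and sM :: "'f \<Rightarrow> 'm::ab_group_add \<Rightarrow> 'm"
    and lact :: "'l \<Rightarrow> 'm \<Rightarrow> 'm"
    and ract :: "'m \<Rightarrow> 'l \<Rightarrow> 'm"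
  assumes "leibniz_algebra sL mult"
    and "fin_dim sL"
    and "semisimple sL mult"
    and "leib_bimodule sL mult sM lact ract"
    and "fin_dim sM"
    and "right_inv ract = {0}"
  shows "\<forall>n. HL_vanishes sL mult sM lact ract n"
proof -
  obtain BL where BL: "finite_dimensional_vector_space sL BL" using assms(2) by (auto simp: fin_dim_def)
  obtain BM where BM: "finite_dimensional_vector_space sM BM" using assms(5) by (auto simp: fin_dim_def)
  interpret L: finite_dimensional_vector_space sL BL by (rule BL)
  obtain lbs where lbs: "set lbs = BL" "distinct lbs" using finite_distinct_list[OF L.finite_Basis] by blast
  note module = assms(4)[unfolded leib_bimodule_def]
  \<comment> \<open>The second and third bimodule laws have opposite right-hand sides; adding them
    gives the claim.\<close>
  have "lact x m + ract m x \<in> right_inv ract" for x m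
  proof -
    have "Vector_Spaces.linear sM sM (\<lambda>m. ract m y)" for y using module by (simp add: bilinear_map_def)
    hence "ract (a + b) y = ract a y + ract b y" for a b y by (simp add: Vector_Spaces.linear_iff)
    thus ?thesis using module by (simp add: right_inv_def)
  qed
  hence ract: "ract m x = - lact x m" for x m using assms(6) by (simp add: eq_neg_iff_add_eq_0 add.commute)
  interpret leibniz_cochains sL BL mult lbs sM BM lact
  proof (intro leibniz_cochains.intro semisimple_leibniz.intro leibniz.intro BL BM
      leibniz_axioms.intro semisimple_leibniz_axioms.intro leibniz_cochains_axioms.intro)
    show "bilinear_map sL sL sL mult" using assms(1) by (simp add: leibniz_algebra_def)
    show "mult x (mult y z) = mult (mult x y) z + mult y (mult x z)" for x y z
      using assms(1) unfolding leibniz_algebra_def by blast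
    show "bilinear_map sL sM sM lact" using module by (elim conjE)
    show "lact (mult x y) m = lact x (lact y m) - lact y (lact x m)" for x y m
      using module by (elim conjE) (elim allE)
    show "m = 0" if "\<And>x. lact x m = 0" for m
    proof -
      have "m \<in> right_inv ract" using that by (simp add: right_inv_def ract)
      thus ?thesis using assms(6) by simp
    qed
  qed (fact assms(3) lbs)+
  show ?thesis using HL_vanishes_symmetric[OF ract] by blast
qed

end
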